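(* Let $G$ be a totally disconnected, locally compact group, let $D$ be a subgroup of $G$ (not necessarily closed), and let $X \subseteq \overline{D}$. Suppose that there is an open subgroup $U$ of $G$ such that $U \cap G^\dagger_X \le \mathrm{N}_G(D)$. Then $G^\dagger_{X} \le D$.
   Context: Topological groups are Hausdorff. For $g \in G$, $\mathrm{con}(g) = \{x \in G \mid g^n x g^{-n} \to 1 \text{ as } n \to +\infty\}$. For a subset $X \subseteq G$, the relative Tits core is the abstract subgroup $G^\dagger_X := \langle \overline{\mathrm{con}(x)} \mid x \in X \cup X^{-1}\rangle$. *)

theory Defs
  imports "HOL-Analysis.Analysis" "HOL-Algebra.Group_Action" "HOL-Algebra.Generated_Groups"
begin

text \<open>This HOL-Algebra notation clashes with the topological closure operator.\<close>

no_notation eq_closure_of (\<open>closure'_of\<index>\<close>)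

text \<open>Topological groups are Hausdorff by convention.\<close>

locale topological_group = group G for G (structure) +
  fixes T :: "'a topology"
  assumes topspace_eq: "topspace T = carrier G"
    and continuous_mult: "continuous_map (prod_topology T T) T (\<lambda>(x, y). x \<otimes> y)"
    and continuous_inv: "continuous_map T T (\<lambda>x. inv x)"
    and Hausdorff: "Hausdorff_space T"

definition totally_disconnected_space :: "'a topology \<Rightarrow> bool" where
  "totally_disconnected_space T \<longleftrightarrow>
    (\<forall>x \<in> topspace T. connected_component_of_set T x = {x})"

definition contraction_group :: "('a, 'b) monoid_scheme \<Rightarrow> 'a topology \<Rightarrow> 'a \<Rightarrow> 'a set" where
  "contraction_group G T g =
    {x \<in> carrier G.
      limitin T (\<lambda>n::nat. g [^]\<^bsub>G\<^esub> n \<otimes>\<^bsub>G\<^esub> x \<otimes>\<^bsub>G\<^esub> inv\<^bsub>G\<^esub> (g [^]\<^bsub>G\<^esub> n)) \<one>\<^bsub>G\<^esub> sequentially}"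

text \<open>The relative Tits core is the abstract subgroup generated by the closures; it is
  not closed in general.\<close>

definition relative_Tits_core :: "('a, 'b) monoid_scheme \<Rightarrow> 'a topology \<Rightarrow> 'a set \<Rightarrow> 'a set" where
  "relative_Tits_core G T X =
    generate G (\<Union>x \<in> X \<union> set_inv\<^bsub>G\<^esub> X. T closure_of (contraction_group G T x))"

end

theory Submission
  imports Defs
begin

text \<open>Let \<open>\<alpha>\<close> be conjugation by \<open>x\<close> and \<open>C\<close> the closure of \<open>con(x)\<close>.

  If \<open>x\<close> normalises \<open>D\<close> and all commutators \<open>u \<alpha>(u)\<^sup>-\<^sup>1\<close> with \<open>u \<in> C\<close> small lie in \<open>D\<close>, then
  \<open>con(x) \<le> D\<close>, since a contracted element \<open>c\<close> is \<open>u \<alpha>(u)\<^sup>-\<^sup>1\<close> for \<open>u = c \<alpha>(c) \<alpha>\<^sup>2(c) \<dots>\<close>.  As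
  \<open>con(x)\<close> is dense in \<open>C\<close>, all commutators \<open>u \<alpha>(u)\<^sup>-\<^sup>1\<close> with \<open>u \<in> C\<close> then lie in \<open>D\<close>.  Density also
  makes the images \<open>\<alpha>\<^sup>n(W)\<close> of a compact open subgroup \<open>W\<close> of \<open>C\<close> uniformly bounded, so \<open>C\<close> has a
  compact open subgroup \<open>M\<close> with \<open>\<alpha>(M) \<le> M\<close>; the image of \<open>M\<close> under \<open>u \<mapsto> u \<alpha>(u)\<^sup>-\<^sup>1\<close> is closed and
  contains \<open>con(x) \<inter> M\<close>, hence \<open>M\<close>.  Thus \<open>M \<le> D\<close> and \<open>C = con(x) M \<le> D\<close>.

  If \<open>x\<close> only lies in the closure of \<open>D\<close>, choose \<open>d = x u \<in> D\<close> with \<open>u\<close> in a small compact open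
  subgroup \<open>V\<close>.  For \<open>V\<close> suitable, \<open>V = V\<^sub>- (con(x\<^sup>-\<^sup>1) \<inter> V\<^sub>+)\<close>, and an approximation argument gives
  \<open>t \<in> V\<close> in the closure of \<open>con(x\<^sup>-\<^sup>1)\<close> such that \<open>t\<^sup>-\<^sup>1 d t = x w\<close> with \<open>w \<in> V\<^sub>-\<close>.  This element lies in
  \<open>D\<close> because \<open>t\<close> normalises \<open>D\<close>, and it has the same contraction group as \<open>x\<close>.\<close>

section \<open>Compactness and topological groups\<close>

lemma compactin_nested:
  fixes C :: "nat \<Rightarrow> 'a set"
  assumes "compactin T K" and clo: "\<And>n. closedin T (C n)" and dec: "\<And>n. C (Suc n) \<subseteq> C n"
    and ne: "\<And>n. K \<inter> C n \<noteq> {}"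
  shows "\<exists>x\<in>K. \<forall>n. x \<in> C n"
proof -
  have "(\<Inter>n. K \<inter> C n) \<noteq> {}"
  proof (rule compact_space_imp_nest[of "subtopology T K"])
    show "compact_space (subtopology T K)"
      using assms(1) by (simp add: compact_space_subtopology)
    show "closedin (subtopology T K) (K \<inter> C n)" for n
      using clo[of n] by (auto simp: closedin_subtopology)
    show "decseq (\<lambda>n. K \<inter> C n)"
      unfolding decseq_Suc_iff using dec by blast
  qed (use ne in auto)
  then show ?thesis by blast
qed

text \<open>Otherwise the sets \<open>K \<inter> C n - N\<close> are nested, closed in
  \<open>K\<close> and nonempty, so they have a common point. In this form a condition at all times
  is replaced by finitely many times, up to an open error.\<close>

lemma compactin_nested_open:
  fixes C :: "nat \<Rightarrow> 'a set"
  assumes "compactin T K" and clo: "\<And>n. closedin T (C n)" and dec: "\<And>n. C (Suc n) \<subseteq> C n"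
    and N: "openin T N" "\<And>x. \<lbrakk>x \<in> K; \<And>n. x \<in> C n\<rbrakk> \<Longrightarrow> x \<in> N"
  shows "\<exists>n. K \<inter> C n \<subseteq> N"
proof (rule ccontr)
  assume "\<not> ?thesis"
  then have "K \<inter> (C n \<inter> (topspace T - N)) \<noteq> {}" for n
    using assms(1) compactin_subset_topspace by blast
  from compactin_nested[OF assms(1), of "\<lambda>n. C n \<inter> (topspace T - N)", OF _ _ this]
  show False using clo dec N by blast
qed

context group
begin

lemma inv_mult_cancel [simp]: "\<lbrakk>x \<in> carrier G; y \<in> carrier G\<rbrakk> \<Longrightarrow> inv x \<otimes> (x \<otimes> y) = y"
  by (metis inv_closed l_inv l_one m_assoc)

lemma mult_inv_cancel [simp]: "\<lbrakk>x \<in> carrier G; y \<in> carrier G\<rbrakk> \<Longrightarrow> x \<otimes> (inv x \<otimes> y) = y"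
  by (metis inv_closed r_inv l_one m_assoc)

end

section \<open>Open sets, cosets, compactness and closures in topological groups\<close>

context topological_group
begin

lemma continuous_map_mult:
  "\<lbrakk>continuous_map X T f; continuous_map X T g\<rbrakk> \<Longrightarrow> continuous_map X T (\<lambda>x. f x \<otimes> g x)"
  using continuous_map_compose[OF continuous_map_pairedI continuous_mult, of X f g]
  by (simp add: o_def)

lemma continuous_map_minv:
  "continuous_map X T f \<Longrightarrow> continuous_map X T (\<lambda>x. inv (f x))"
  using continuous_map_compose[OF _ continuous_inv, of X f] by (simp add: o_def)

lemma continuous_map_ident: "continuous_map T T (\<lambda>x. x)"
  by (simp flip: id_def)

lemma continuous_map_constant: "c \<in> carrier G \<Longrightarrow> continuous_map X T (\<lambda>x. c)"
  by (simp add: topspace_eq)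

lemmas continuous_group_intros =
  continuous_map_mult continuous_map_minv continuous_map_ident continuous_map_constant

lemma openin_preimage:
  "\<lbrakk>continuous_map T T f; openin T N\<rbrakk> \<Longrightarrow> openin T {x \<in> carrier G. f x \<in> N}"
  using openin_continuous_map_preimage[of T T f N] by (simp add: topspace_eq)

lemma closedin_preimage:
  "\<lbrakk>continuous_map T T f; closedin T N\<rbrakk> \<Longrightarrow> closedin T {x \<in> carrier G. f x \<in> N}"
  using closedin_continuous_map_preimage[of T T f N] by (simp add: topspace_eq)

lemma openin_carrier: "openin T N \<Longrightarrow> N \<subseteq> carrier G"
  using openin_subset topspace_eq by metis

lemma compactin_carrier: "compactin T N \<Longrightarrow> N \<subseteq> carrier G"
  using compactin_subset_topspace topspace_eq by metis

lemma compactin_closed: "compactin T K \<Longrightarrow> closedin T K"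
  using Hausdorff compactin_imp_closedin by blast

lemma closedin_sing: "x \<in> carrier G \<Longrightarrow> closedin T {x}"
  using Hausdorff by (simp add: topspace_eq closedin_Hausdorff_singleton)

lemma openin_left_coset:
  "\<lbrakk>openin T N; x \<in> carrier G\<rbrakk> \<Longrightarrow> openin T {y \<in> carrier G. inv x \<otimes> y \<in> N}"
  by (intro openin_preimage continuous_group_intros) auto

lemma openin_set_mult:
  assumes "openin T N" "Q \<subseteq> carrier G"
  shows "openin T (Q <#> N)"
proof -
  have "Q <#> N = (\<Union>q\<in>Q. {y \<in> carrier G. inv q \<otimes> y \<in> N})" (is "_ = ?U")
  proof
    show "Q <#> N \<subseteq> ?U"
      using assms(2) openin_carrier[OF assms(1)] by (auto simp: set_mult_def subsetD)
    show "?U \<subseteq> Q <#> N"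
    proof
      fix y assume "y \<in> ?U"
      then obtain q where q: "q \<in> Q" "y \<in> carrier G" "inv q \<otimes> y \<in> N" by auto
      then have "y = q \<otimes> (inv q \<otimes> y)" using assms(2) by (simp add: subsetD)
      then show "y \<in> Q <#> N" unfolding set_mult_def using q by blast
    qed
  qed
  then show ?thesis
    using openin_left_coset[OF assms(1)] assms(2) by (auto intro!: openin_Union)
qed

lemma openin_subgroup:
  assumes "subgroup H G" "openin T N" "\<one> \<in> N" "N \<subseteq> H"
  shows "openin T H"
proof -
  have sub: "H \<subseteq> carrier G"
    using assms(1) by (simp add: subgroup.subset)
  have "H <#> N = H"
  proof
    show "H <#> N \<subseteq> H"
      using assms by (auto simp: set_mult_def subgroup.m_closed subset_iff)
    show "H \<subseteq> H <#> N"
      using assms(3) sub by (force simp: set_mult_def)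
  qed
  then show ?thesis
    using openin_set_mult[OF assms(2), of H] sub by simp
qed

lemma closedin_open_subgroup:
  assumes "subgroup H G" "openin T H"
  shows "closedin T H"
proof -
  have sub: "H \<subseteq> carrier G"
    using assms(1) by (simp add: subgroup.subset)
  have "carrier G - H = (\<Union>x\<in>carrier G - H. {y \<in> carrier G. inv x \<otimes> y \<in> H})" (is "_ = ?U")
  proof
    show "carrier G - H \<subseteq> ?U"
      using assms(1) by (auto simp: subgroup.one_closed)
    show "?U \<subseteq> carrier G - H"
    proof clarsimp
      fix x y assume *: "x \<in> carrier G" "x \<notin> H" "y \<in> carrier G" "inv x \<otimes> y \<in> H" "y \<in> H"
      then have "y \<otimes> inv (inv x \<otimes> y) \<in> H"
        using assms(1) by (meson subgroup.m_closed subgroup.m_inv_closed)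
      moreover have "y \<otimes> inv (inv x \<otimes> y) = x"
        using * by (simp add: inv_mult_group)
      ultimately show False using * by simp
    qed
  qed
  moreover have "openin T ?U"
    using openin_left_coset[OF assms(2)] by (auto intro!: openin_Union)
  ultimately show ?thesis
    using sub by (simp add: closedin_def topspace_eq)
qed

lemma compactin_set_mult:
  assumes "compactin T K" "compactin T L"
  shows "compactin T (K <#> L)"
proof -
  have "compactin T ((\<lambda>(x, y). x \<otimes> y) ` (K \<times> L))"
    using assms continuous_mult by (auto intro!: image_compactin simp: compactin_Times)
  moreover have "(\<lambda>(x, y). x \<otimes> y) ` (K \<times> L) = K <#> L"
    by (auto simp: set_mult_def)
  ultimately show ?thesis by simp
qed

text \<open>The translates \<open>s W\<close> are open and cover \<open>K\<close>. Taking the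
  representatives from a prescribed set \<open>S\<close> matters later, where \<open>S\<close> is a
  contraction group.\<close>

lemma finite_coset_cover:
  assumes K: "compactin T K" and W: "openin T W" and S: "S \<subseteq> carrier G"
    and cov: "\<And>k. k \<in> K \<Longrightarrow> \<exists>s\<in>S. inv s \<otimes> k \<in> W"
  shows "\<exists>F. finite F \<and> F \<subseteq> S \<and> (\<forall>k\<in>K. \<exists>s\<in>F. inv s \<otimes> k \<in> W)"
proof -
  let ?f = "\<lambda>x. {y \<in> carrier G. inv x \<otimes> y \<in> W}"
  have sub: "K \<subseteq> \<Union> (?f ` S)"
  proof
    fix k assume "k \<in> K"
    then obtain s where "s \<in> S" "inv s \<otimes> k \<in> W" using cov by blast
    then show "k \<in> \<Union> (?f ` S)" using compactin_carrier[OF K] \<open>k \<in> K\<close> by auto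
  qed
  have "openin T U" if "U \<in> ?f ` S" for U
    using that openin_left_coset[OF W] S by (auto simp: subsetD)
  from compactinD[OF K this sub] obtain \<F>
    where \<F>: "finite \<F>" "\<F> \<subseteq> ?f ` S" "K \<subseteq> \<Union>\<F>" by blast
  from finite_subset_image[OF \<F>(1,2)] \<F>(3)
  obtain F where "finite F" "F \<subseteq> S" "K \<subseteq> \<Union> (?f ` F)" by blast
  then have "\<exists>s\<in>F. inv s \<otimes> k \<in> W" if "k \<in> K" for k
    using that by auto
  then show ?thesis using \<open>finite F\<close> \<open>F \<subseteq> S\<close> by blast
qed

text \<open>Covering the inverses of \<open>K\<close> by finitely many left cosets of
  \<open>W\<close> gives finitely many \<open>f\<close> such that every \<open>k\<close> has
  \<open>f \<otimes> inv k\<close> in \<open>W\<close> for one of them. Then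
  \<open>k \<otimes> x \<otimes> inv k\<close> and \<open>f \<otimes> x \<otimes> inv f\<close> are
  conjugate under \<open>W\<close>, so finitely many open conditions suffice.\<close>

lemma openin_conj_core:
  assumes K: "compactin T K" and W: "subgroup W G" "openin T W"
  shows "openin T {x \<in> carrier G. \<forall>k\<in>K. k \<otimes> x \<otimes> inv k \<in> W}"
proof -
  have Kc: "K \<subseteq> carrier G" and Wc: "W \<subseteq> carrier G"
    using compactin_carrier[OF K] openin_carrier[OF W(2)] .
  have "compactin T ((\<lambda>x. inv x) ` K)"
    using image_compactin[OF K continuous_inv] .
  then obtain F' where F': "finite F'" "F' \<subseteq> (\<lambda>x. inv x) ` K"
      "\<forall>k\<in>(\<lambda>x. inv x) ` K. \<exists>s\<in>F'. inv s \<otimes> k \<in> W"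
  proof (rule finite_coset_cover[THEN exE])
    show "openin T W" by (rule W)
    show "(\<lambda>x. inv x) ` K \<subseteq> carrier G" using Kc by auto
    show "\<exists>s\<in>(\<lambda>x. inv x) ` K. inv s \<otimes> k \<in> W" if "k \<in> (\<lambda>x. inv x) ` K" for k
      using that W(1) Kc by (intro bexI[of _ k]) (auto simp: subgroup.one_closed subsetD)
  qed blast
  from finite_subset_image[OF F'(1,2)]
  obtain F where F: "finite F" "F \<subseteq> K" "F' = (\<lambda>x. inv x) ` F" by blast
  have Fc: "F \<subseteq> carrier G" using F Kc by blast
  have cov: "\<exists>f\<in>F. f \<otimes> inv k \<in> W" if "k \<in> K" for k
  proof -
    have "\<exists>s\<in>F'. inv s \<otimes> inv k \<in> W" using F'(3) imageI[OF that] by (rule bspec)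
    then obtain f where f: "f \<in> F" "inv (inv f) \<otimes> inv k \<in> W" unfolding F(3) by auto
    moreover have "f \<in> carrier G" using f(1) Fc by (rule rev_subsetD)
    ultimately show ?thesis by (intro bexI[of _ f]) simp_all
  qed
  have "k \<otimes> x \<otimes> inv k \<in> W" if "\<forall>f\<in>F. f \<otimes> x \<otimes> inv f \<in> W" "k \<in> K" "x \<in> carrier G" for x k
  proof -
    obtain f where f: "f \<in> F" "f \<otimes> inv k \<in> W" using cov \<open>k \<in> K\<close> by blast
    have c: "f \<in> carrier G" "k \<in> carrier G"
      using rev_subsetD[OF f(1) Fc] rev_subsetD[OF \<open>k \<in> K\<close> Kc] .
    have "inv (f \<otimes> inv k) \<otimes> (f \<otimes> x \<otimes> inv f) \<otimes> (f \<otimes> inv k) \<in> W"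
      using that f W(1) by (meson subgroup.m_closed subgroup.m_inv_closed)
    also have "inv (f \<otimes> inv k) \<otimes> (f \<otimes> x \<otimes> inv f) \<otimes> (f \<otimes> inv k) = k \<otimes> x \<otimes> inv k"
      using c that by (simp add: inv_mult_group m_assoc)
    finally show ?thesis .
  qed
  \<comment> \<open>\<open>F\<close> is empty when \<open>K\<close> is, and the intersection over
    \<open>F\<close> is then the whole type; the factor \<open>carrier G\<close> covers this
    case.\<close>
  then have eq: "{x \<in> carrier G. \<forall>k\<in>K. k \<otimes> x \<otimes> inv k \<in> W}
      = carrier G \<inter> (\<Inter>f\<in>F. {x \<in> carrier G. f \<otimes> x \<otimes> inv f \<in> W})"
    using F(2) by blast
  have "openin T {x \<in> carrier G. f \<otimes> x \<otimes> inv f \<in> W}" if "f \<in> F" for f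
    using that Fc by (intro openin_preimage continuous_group_intros W(2)) auto
  moreover have "openin T (carrier G)" using openin_topspace[of T] topspace_eq by simp
  ultimately show ?thesis
    unfolding eq using F(1) by (cases "F = {}") auto
qed

lemma closure_approx:
  assumes "c \<in> T closure_of S" "openin T W" "\<one> \<in> W"
  shows "\<exists>s\<in>S. s \<in> carrier G \<and> inv c \<otimes> s \<in> W"
proof -
  have c: "c \<in> carrier G" using assms(1) by (simp add: in_closure_of topspace_eq)
  then have "c \<in> {y \<in> carrier G. inv c \<otimes> y \<in> W}" using assms(3) by simp
  moreover have "\<exists>y\<in>S. y \<in> N" if "c \<in> N" "openin T N" for N
    using assms(1) that by (auto simp: in_closure_of)
  ultimately show ?thesis
    using openin_left_coset[OF assms(2) c] by (metis (no_types, lifting) mem_Collect_eq)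
qed

lemma closure_carrier: "T closure_of S \<subseteq> carrier G"
  using closure_of_subset_topspace[of T S] by (simp add: topspace_eq)

lemma subgroup_closure_of:
  assumes "subgroup H G"
  shows "subgroup (T closure_of H) G"
proof -
  have H: "H \<subseteq> carrier G" using assms by (simp add: subgroup.subset)
  then have HT: "H \<subseteq> T closure_of H" by (simp add: closure_of_subset topspace_eq)
  show ?thesis
  proof (rule subgroupI)
    show "T closure_of H \<noteq> {}" using HT subgroup.one_closed[OF assms] by blast
    show "inv a \<in> T closure_of H" if "a \<in> T closure_of H" for a
    proof -
      have "inv a \<in> T closure_of ((\<lambda>x. inv x) ` H)"
        using continuous_map_image_closure_subset[OF continuous_inv, of H] that by blast
      moreover have "(\<lambda>x. inv x) ` H \<subseteq> H"
        using assms by (auto simp: subgroup.m_inv_closed)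
      ultimately show ?thesis using closure_of_mono by blast
    qed
    show "a \<otimes> b \<in> T closure_of H" if "a \<in> T closure_of H" "b \<in> T closure_of H" for a b
    proof -
      have "(a, b) \<in> prod_topology T T closure_of (H \<times> H)"
        using that by (simp add: closure_of_Times)
      then have "a \<otimes> b \<in> T closure_of ((\<lambda>(x, y). x \<otimes> y) ` (H \<times> H))"
        using continuous_map_image_closure_subset[OF continuous_mult, of "H \<times> H"] by force
      moreover have "(\<lambda>(x, y). x \<otimes> y) ` (H \<times> H) \<subseteq> H"
        using assms by (auto simp: subgroup.m_closed)
      ultimately show ?thesis using closure_of_mono by blast
    qed
  qed (rule closure_carrier)
qed

text \<open>Van Dantzig's theorem. The component of \<open>\<one>\<close> is a point, which gives a
  compact open neighbourhood \<open>K\<close> of \<open>\<one>\<close> inside \<open>N\<close>. The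
  stabiliser \<open>H\<close> of \<open>K\<close> under left translation lies in \<open>K\<close>
  because \<open>\<one>\<close> does, and it is open by the tube lemma.\<close>

theorem small_open_subgroup:
  assumes "totally_disconnected_space T" "locally_compact_space T" "openin T N" "\<one> \<in> N"
  shows "\<exists>V. subgroup V G \<and> openin T V \<and> compactin T V \<and> V \<subseteq> N"
proof -
  obtain L M where L: "openin T L" "compactin T M" "\<one> \<in> L" "L \<subseteq> M"
    using assms(2) unfolding locally_compact_space_def by (metis one_closed topspace_eq)
  have "{\<one>} \<in> connected_components_of T"
    using assms(1) unfolding totally_disconnected_space_def connected_components_of_def
    by (metis image_eqI one_closed topspace_eq)
  moreover have "compactin T {\<one>}" by (simp add: topspace_eq)
  moreover have "openin T (N \<inter> L)" "{\<one>} \<subseteq> N \<inter> L"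
    using assms L by auto
  \<comment> \<open>A compact component can be cut out of any of its neighbourhoods by a clopen set.
    Staying inside \<open>L\<close>, hence inside the compact set \<open>M\<close>, makes
    \<open>K\<close> compact.\<close>
  ultimately obtain K K' where K: "openin T K" "openin T K'" "disjnt K K'" "K \<union> K' = topspace T"
      "{\<one>} \<subseteq> K" "K \<subseteq> N \<inter> L"
    using wilder_locally_compact_component_thm[OF assms(2) Hausdorff] by metis
  have "closedin T K"
  proof -
    have "topspace T - K = K'" using K(3,4) by (auto simp: disjnt_def)
    then show ?thesis using K(1,2) openin_subset by (auto simp: closedin_def)
  qed
  then have cK: "compactin T K"
    using L K closed_compactin by (metis le_inf_iff subset_trans)
  have Kc: "K \<subseteq> carrier G" using openin_carrier[OF K(1)] .
  define H where "H = {g \<in> carrier G. \<forall>k\<in>K. g \<otimes> k \<in> K \<and> inv g \<otimes> k \<in> K}"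
  have H: "subgroup H G"
  proof (rule subgroupI)
    have "\<one> \<in> H" using Kc by (auto simp: H_def subsetD)
    then show "H \<noteq> {}" by blast
    show "a \<otimes> b \<in> H" if "a \<in> H" "b \<in> H" for a b
      using that Kc by (auto simp: H_def inv_mult_group m_assoc subsetD)
  qed (auto simp: H_def)
  have HK: "H \<subseteq> K"
    using K(5) by (force simp: H_def)
  \<comment> \<open>The tube around the compact slice \<open>{\<one>} \<times> K\<close> yields a
    neighbourhood \<open>A\<close> of \<open>\<one>\<close> with \<open>A K\<close> inside
    \<open>K\<close>; intersecting \<open>A\<close> with its inverse lands in
    \<open>H\<close>.\<close>
  let ?P = "{p \<in> topspace (prod_topology T T). (case p of (g, k) \<Rightarrow> g \<otimes> k) \<in> K}"
  have "openin (prod_topology T T) ?P"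
    using openin_continuous_map_preimage[OF continuous_mult K(1)] .
  moreover have "{\<one>} \<times> K \<subseteq> ?P"
    using Kc by (auto simp: topspace_eq)
  ultimately obtain A B where A: "openin T A" "openin T B" "{\<one>} \<subseteq> A" "K \<subseteq> B" "A \<times> B \<subseteq> ?P"
    using Wallace_theorem_prod_topology[of T "{\<one>}" T K ?P] cK
    by (auto simp: topspace_eq)
  let ?A = "A \<inter> {x \<in> carrier G. inv x \<in> A}"
  have "?A \<subseteq> H"
  proof
    fix g assume "g \<in> ?A"
    have mem: "a \<otimes> k \<in> K" if "a \<in> A" "k \<in> K" for a k
    proof -
      have "(a, k) \<in> A \<times> B" using that A(4) by (simp add: rev_subsetD)
      then have "(a, k) \<in> ?P" using A(5) by (rule rev_subsetD)
      then show ?thesis by simp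
    qed
    have "g \<otimes> k \<in> K \<and> inv g \<otimes> k \<in> K" if "k \<in> K" for k
      using mem[OF _ that] \<open>g \<in> ?A\<close> by simp
    then show "g \<in> H" using \<open>g \<in> ?A\<close> by (simp add: H_def)
  qed
  moreover have "openin T ?A" "\<one> \<in> ?A"
    using openin_preimage[OF continuous_inv A(1)] A by auto
  ultimately have oH: "openin T H" using openin_subgroup H by blast
  have "compactin T H"
    using closedin_open_subgroup[OF H oH] cK HK closed_compactin by blast
  then show ?thesis using H oH HK K(6) by blast
qed

end

section \<open>Automorphisms and tidiness above\<close>

text \<open>For an automorphism \<open>\<alpha>\<close> with inverse \<open>\<beta>\<close>, the groups written \<open>V\<^sub>-\<close> and \<open>V\<^sub>+\<close> in the literature are
  \<open>forward_part \<alpha> V\<close> and \<open>forward_part \<beta> V\<close>.\<close>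

definition forward_part :: "('a \<Rightarrow> 'a) \<Rightarrow> 'a set \<Rightarrow> 'a set" where
  "forward_part f V = {x. \<forall>n. (f ^^ n) x \<in> V}"

lemma forward_partD: "x \<in> forward_part f V \<Longrightarrow> (f ^^ n) x \<in> V"
  by (simp add: forward_part_def)

lemma forward_part_subset: "forward_part f V \<subseteq> V"
  using forward_partD[where n = 0] by auto

lemma forward_part_mono: "V \<subseteq> W \<Longrightarrow> forward_part f V \<subseteq> forward_part f W"
  by (auto simp: forward_part_def)

lemma forward_part_step: "x \<in> forward_part f V \<Longrightarrow> f x \<in> forward_part f V"
  unfolding forward_part_def
proof clarsimp
  fix n assume *: "\<forall>n. (f ^^ n) x \<in> V"
  show "(f ^^ n) (f x) \<in> V"
    using spec[OF *, of "Suc n"] by (simp add: funpow_swap1)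
qed

lemma forward_part_steps: "x \<in> forward_part f V \<Longrightarrow> (f ^^ n) x \<in> forward_part f V"
  by (induction n) (auto simp: forward_part_step)

text \<open>The conclusion of van Dantzig's theorem is the only consequence of total
  disconnectedness and local compactness used from here on.\<close>

locale locally_profinite_group = topological_group G T for G (structure) and T +
  assumes small_subgroups: "\<lbrakk>openin T N; \<one> \<in> N\<rbrakk> \<Longrightarrow>
      \<exists>V. subgroup V G \<and> openin T V \<and> compactin T V \<and> V \<subseteq> N"

text \<open>The inverse is a parameter, so exchanging \<open>\<alpha>\<close> and
  \<open>\<beta>\<close> gives an instance of the same locale and every fact holds for both time
  directions.\<close>

locale topological_automorphism = locally_profinite_group G T for G (structure) and T +
  fixes \<alpha> \<beta> :: "'a \<Rightarrow> 'a"
  assumes hom_forward: "\<alpha> \<in> hom G G" and hom_backward: "\<beta> \<in> hom G G"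
    and continuous_forward: "continuous_map T T \<alpha>"
    and continuous_backward: "continuous_map T T \<beta>"
    and backward_forward [simp]: "x \<in> carrier G \<Longrightarrow> \<beta> (\<alpha> x) = x"
    and forward_backward [simp]: "x \<in> carrier G \<Longrightarrow> \<alpha> (\<beta> x) = x"

text \<open>Facts about the inverse automorphism, with prefix \<open>swap\<close>, appear only when the context is
  reopened.\<close>

sublocale topological_automorphism \<subseteq> swap: topological_automorphism G T \<beta> \<alpha>
  by unfold_locales
    (simp_all add: hom_forward hom_backward continuous_forward continuous_backward)

section \<open>Iterates of an automorphism and of its inverse\<close>

context topological_automorphism
begin

lemma iter_hom: "\<alpha> ^^ n \<in> hom G G"
proof (induction n)
  case (Suc n)
  then show ?case using hom_forward by (auto simp: hom_def Pi_iff)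
qed (auto simp: hom_def)

lemma iter_closed [simp]: "x \<in> carrier G \<Longrightarrow> (\<alpha> ^^ n) x \<in> carrier G"
  using hom_in_carrier[OF iter_hom] .

lemma iter_mult [simp]:
  "\<lbrakk>x \<in> carrier G; y \<in> carrier G\<rbrakk> \<Longrightarrow> (\<alpha> ^^ n) (x \<otimes> y) = (\<alpha> ^^ n) x \<otimes> (\<alpha> ^^ n) y"
  using hom_mult[OF iter_hom] .

lemma group_hom_iter: "group_hom G G (\<alpha> ^^ n)"
  using iter_hom by (simp add: group_hom_def group_hom_axioms_def is_group)

lemma iter_one [simp]: "(\<alpha> ^^ n) \<one> = \<one>"
  using group_hom.hom_one[OF group_hom_iter] .

lemma iter_inv [simp]: "x \<in> carrier G \<Longrightarrow> (\<alpha> ^^ n) (inv x) = inv ((\<alpha> ^^ n) x)"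
  using group_hom.hom_inv[OF group_hom_iter] .

lemma step_closed [simp]: "x \<in> carrier G \<Longrightarrow> \<alpha> x \<in> carrier G"
  using iter_closed[of x 1] by simp

lemma step_mult [simp]: "\<lbrakk>x \<in> carrier G; y \<in> carrier G\<rbrakk> \<Longrightarrow> \<alpha> (x \<otimes> y) = \<alpha> x \<otimes> \<alpha> y"
  using iter_mult[of x y 1] by simp

lemma step_one [simp]: "\<alpha> \<one> = \<one>"
  using iter_one[of 1] by simp

lemma step_inv [simp]: "x \<in> carrier G \<Longrightarrow> \<alpha> (inv x) = inv (\<alpha> x)"
  using iter_inv[of x 1] by simp

lemma continuous_iter: "continuous_map T T (\<alpha> ^^ n)"
proof (induction n)
  case (Suc n)
  then show ?case
    using continuous_map_compose[OF Suc continuous_forward] by (simp add: o_def)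
qed (simp add: id_def[symmetric])

end

context topological_automorphism
begin

lemma iter_cancel_add: "x \<in> carrier G \<Longrightarrow> (\<alpha> ^^ i) ((\<beta> ^^ (i + j)) x) = (\<beta> ^^ j) x"
proof (induction i)
  case (Suc i)
  have "(\<alpha> ^^ Suc i) ((\<beta> ^^ (Suc i + j)) x) = (\<alpha> ^^ i) (\<alpha> (\<beta> ((\<beta> ^^ (i + j)) x)))"
    by (simp only: funpow_Suc_right[of i \<alpha>] add_Suc funpow.simps(2)[of "i + j" \<beta>] o_apply)
  then show ?case using Suc by simp
qed simp

lemma iter_cancel [simp]: "x \<in> carrier G \<Longrightarrow> (\<alpha> ^^ i) ((\<beta> ^^ i) x) = x"
  using iter_cancel_add[of x i 0] by simp

lemma iter_cancel_le: "\<lbrakk>x \<in> carrier G; i \<le> k\<rbrakk> \<Longrightarrow> (\<alpha> ^^ i) ((\<beta> ^^ k) x) = (\<beta> ^^ (k - i)) x"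
  using iter_cancel_add[of x i "k - i"] by simp

lemma iter_cancel_ge: "\<lbrakk>x \<in> carrier G; k \<le> i\<rbrakk> \<Longrightarrow> (\<alpha> ^^ i) ((\<beta> ^^ k) x) = (\<alpha> ^^ (i - k)) x"
  using funpow_add[of "i - k" k \<alpha>] by simp

lemma iter_iter: "(\<alpha> ^^ i) ((\<alpha> ^^ k) x) = (\<alpha> ^^ (i + k)) x"
  by (simp add: funpow_add)

lemma subgroup_preimage_iter:
  assumes "subgroup V G"
  shows "subgroup {x \<in> carrier G. (\<alpha> ^^ n) x \<in> V} G"
proof (rule subgroupI)
  have "\<one> \<in> {x \<in> carrier G. (\<alpha> ^^ n) x \<in> V}" using assms by (simp add: subgroup.one_closed)
  then show "{x \<in> carrier G. (\<alpha> ^^ n) x \<in> V} \<noteq> {}" by blast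
qed (use assms in \<open>auto simp: subgroup.m_closed subgroup.m_inv_closed\<close>)

lemma openin_preimage_iter: "openin T V \<Longrightarrow> openin T {x \<in> carrier G. (\<alpha> ^^ n) x \<in> V}"
  by (intro openin_preimage continuous_iter)

lemma closedin_preimage_iter: "closedin T V \<Longrightarrow> closedin T {x \<in> carrier G. (\<alpha> ^^ n) x \<in> V}"
  by (intro closedin_preimage continuous_iter)

lemma forward_part_eq:
  assumes "V \<subseteq> carrier G"
  shows "forward_part \<alpha> V = (\<Inter>n. {x \<in> carrier G. (\<alpha> ^^ n) x \<in> V})"
proof
  show "forward_part \<alpha> V \<subseteq> (\<Inter>n. {x \<in> carrier G. (\<alpha> ^^ n) x \<in> V})"
    using forward_part_subset[of \<alpha> V] assms by (auto simp: forward_partD)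
qed (auto simp: forward_part_def)

lemma subgroup_forward_part:
  assumes "subgroup V G"
  shows "subgroup (forward_part \<alpha> V) G"
  unfolding forward_part_eq[OF subgroup.subset[OF assms]]
  using subgroup_preimage_iter[OF assms] by (intro subgroups_Inter) auto

lemma closedin_forward_part: "closedin T V \<Longrightarrow> closedin T (forward_part \<alpha> V)"
  using forward_part_eq[of V] closedin_preimage_iter[of V] closedin_subset[of T V]
  by (auto simp: topspace_eq)

end

section \<open>Back cores and contraction groups\<close>

context topological_automorphism
begin

text \<open>The intersection of the images of \<open>V\<close> under the first iterates of
  \<open>\<alpha>\<close>, up to the \<open>n\<close>-th; these sets decrease to
  \<open>forward_part \<beta> V\<close>. The version \<open>swap.back_core\<close> uses preimages
  under \<open>\<alpha>\<close> and decreases to \<open>forward_part \<alpha> V\<close>.\<close>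

definition back_core :: "nat \<Rightarrow> 'a set \<Rightarrow> 'a set" where
  "back_core n V = {x \<in> carrier G. \<forall>i\<le>n. (\<beta> ^^ i) x \<in> V}"

lemma back_core_carrier: "back_core n V \<subseteq> carrier G"
  by (simp add: back_core_def)

lemma back_core_subset: "back_core n V \<subseteq> V"
  by (force simp: back_core_def)

lemma back_core_eq: "back_core n V = (\<Inter>i\<in>{..n}. {x \<in> carrier G. (\<beta> ^^ i) x \<in> V})"
  by (auto simp: back_core_def)

lemma back_core_Suc_subset: "back_core (Suc n) V \<subseteq> back_core n V"
  by (auto simp: back_core_def)

lemma subgroup_back_core: "subgroup V G \<Longrightarrow> subgroup (back_core n V) G"
  unfolding back_core_eq using swap.subgroup_preimage_iter[of V] by (intro subgroups_Inter) auto

lemma openin_back_core: "openin T V \<Longrightarrow> openin T (back_core n V)"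
  unfolding back_core_eq using swap.openin_preimage_iter[of V] by (intro openin_INT2) auto

lemma closedin_back_core: "closedin T V \<Longrightarrow> closedin T (back_core n V)"
  unfolding back_core_eq using swap.closedin_preimage_iter[of V] by (intro closedin_INT) auto

lemma compactin_back_core: "compactin T V \<Longrightarrow> compactin T (back_core n V)"
  using closed_compactin[OF _ back_core_subset closedin_back_core] compactin_closed by blast

text \<open>A backward orbit that stays in \<open>V\<close> passes only through points with the same
  property. Hence replacing \<open>V\<close> by a back core shrinks the other factor of the
  decomposition but not this one.\<close>

lemma forward_part_back_core:
  assumes "V \<subseteq> carrier G"
  shows "forward_part \<beta> (back_core n V) = forward_part \<beta> V"
proof
  show "forward_part \<beta> (back_core n V) \<subseteq> forward_part \<beta> V"
    by (rule forward_part_mono[OF back_core_subset])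
  show "forward_part \<beta> V \<subseteq> forward_part \<beta> (back_core n V)"
  proof
    fix x assume x: "x \<in> forward_part \<beta> V"
    have "x \<in> carrier G" using subsetD[OF forward_part_subset x] assms by blast
    moreover have "(\<beta> ^^ i) ((\<beta> ^^ k) x) \<in> V" for i k
      using forward_partD[OF forward_part_steps[OF x]] .
    ultimately have "(\<beta> ^^ k) x \<in> back_core n V" for k
      unfolding back_core_def by simp
    then show "x \<in> forward_part \<beta> (back_core n V)"
      unfolding forward_part_def by blast
  qed
qed

definition contraction :: "'a set" where
  "contraction = {y \<in> carrier G. \<forall>N. openin T N \<longrightarrow> \<one> \<in> N \<longrightarrow> (\<exists>m. \<forall>n\<ge>m. (\<alpha> ^^ n) y \<in> N)}"

lemma contraction_carrier: "contraction \<subseteq> carrier G"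
  by (auto simp: contraction_def)

lemma contractionD:
  "\<lbrakk>y \<in> contraction; openin T N; \<one> \<in> N\<rbrakk> \<Longrightarrow> \<exists>m. \<forall>n\<ge>m. (\<alpha> ^^ n) y \<in> N"
  by (simp add: contraction_def)

lemma contractionI:
  assumes "y \<in> carrier G"
    and "\<And>V. \<lbrakk>subgroup V G; openin T V; compactin T V\<rbrakk> \<Longrightarrow> \<exists>m. \<forall>n\<ge>m. (\<alpha> ^^ n) y \<in> V"
  shows "y \<in> contraction"
  unfolding contraction_def
proof (intro CollectI conjI allI impI)
  fix N assume "openin T N" "\<one> \<in> N"
  then obtain V where "subgroup V G" "openin T V" "compactin T V" "V \<subseteq> N"
    using small_subgroups by blast
  then show "\<exists>m. \<forall>n\<ge>m. (\<alpha> ^^ n) y \<in> N"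
    using assms(2) by (metis subsetD)
qed (rule assms(1))

lemma subgroup_contraction: "subgroup contraction G"
proof (rule subgroupI)
  have "\<one> \<in> contraction" by (auto intro!: contractionI simp: subgroup.one_closed)
  then show "contraction \<noteq> {}" by blast
  show "inv a \<in> contraction" if a: "a \<in> contraction" for a
  proof (rule contractionI)
    have ac: "a \<in> carrier G" using a contraction_carrier by blast
    then show "inv a \<in> carrier G" by simp
    fix V assume V: "subgroup V G" "openin T V" "compactin T V"
    then obtain m where "\<forall>n\<ge>m. (\<alpha> ^^ n) a \<in> V"
      using contractionD[OF a] subgroup.one_closed by blast
    then show "\<exists>m. \<forall>n\<ge>m. (\<alpha> ^^ n) (inv a) \<in> V"
      using ac V(1) by (intro exI[of _ m]) (auto simp: subgroup.m_inv_closed)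
  qed
  show "a \<otimes> b \<in> contraction" if a: "a \<in> contraction" and b: "b \<in> contraction" for a b
  proof (rule contractionI)
    have c: "a \<in> carrier G" "b \<in> carrier G" using a b contraction_carrier by blast+
    then show "a \<otimes> b \<in> carrier G" by simp
    fix V assume V: "subgroup V G" "openin T V" "compactin T V"
    obtain m k where m: "\<forall>n\<ge>m. (\<alpha> ^^ n) a \<in> V" and k: "\<forall>n\<ge>k. (\<alpha> ^^ n) b \<in> V"
      using contractionD[OF a V(2)] contractionD[OF b V(2)] subgroup.one_closed[OF V(1)] by blast
    have "\<forall>n\<ge>max m k. (\<alpha> ^^ n) (a \<otimes> b) \<in> V"
      using c V(1) m k by (auto simp: subgroup.m_closed)
    then show "\<exists>m. \<forall>n\<ge>m. (\<alpha> ^^ n) (a \<otimes> b) \<in> V" by blast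
  qed
qed (rule contraction_carrier)

lemma contraction_forward: 
  assumes "y \<in> contraction" shows "\<alpha> y \<in> contraction"
proof (rule contractionI)
  show "\<alpha> y \<in> carrier G" using assms contraction_carrier by auto
  fix V assume "subgroup V G" "openin T V" "compactin T V"
  then obtain m where m: "\<forall>n\<ge>m. (\<alpha> ^^ n) y \<in> V"
    using contractionD[OF assms] subgroup.one_closed by blast
  have "(\<alpha> ^^ n) (\<alpha> y) \<in> V" if "n \<ge> m" for n
    using m[rule_format, of "Suc n"] that by (simp add: funpow_swap1)
  then show "\<exists>m. \<forall>n\<ge>m. (\<alpha> ^^ n) (\<alpha> y) \<in> V" by blast
qed

end

context topological_automorphism
begin

lemma contraction_backward: 
  assumes "y \<in> contraction" shows "\<beta> y \<in> contraction"
proof (rule contractionI)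
  have y: "y \<in> carrier G" using assms contraction_carrier by auto
  then show "\<beta> y \<in> carrier G" by simp
  fix V assume "subgroup V G" "openin T V" "compactin T V"
  then obtain m where m: "\<forall>n\<ge>m. (\<alpha> ^^ n) y \<in> V"
    using contractionD[OF assms] subgroup.one_closed by blast
  have "(\<alpha> ^^ n) (\<beta> y) \<in> V" if "n \<ge> Suc m" for n
    using m[rule_format, of "n - 1"] that iter_cancel_ge[of y 1 n] y by simp
  then show "\<exists>m. \<forall>n\<ge>m. (\<alpha> ^^ n) (\<beta> y) \<in> V" by blast
qed

lemma contraction_iter: "y \<in> contraction \<Longrightarrow> (\<alpha> ^^ n) y \<in> contraction"
  by (induction n) (auto simp: contraction_forward)

lemma closure_stable:
  assumes "S \<subseteq> carrier G" "\<And>x. x \<in> S \<Longrightarrow> \<alpha> x \<in> S" "x \<in> T closure_of S"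
  shows "\<alpha> x \<in> T closure_of S"
proof -
  have "\<alpha> x \<in> T closure_of (\<alpha> ` S)"
    using continuous_map_image_closure_subset[OF continuous_forward] assms(3) by blast
  moreover have "T closure_of (\<alpha> ` S) \<subseteq> T closure_of S"
    using assms(2) by (intro closure_of_mono) blast
  ultimately show ?thesis by blast
qed

text \<open>Tidying above, carried out inside a closed invariant subgroup: far enough down the
  sequence of back cores, a decomposition that works for one step can be iterated.\<close>

theorem tidy_above:
  assumes V: "subgroup V G" "openin T V" "compactin T V"
    and Q: "subgroup Q G" "closedin T Q" "\<And>x. x \<in> Q \<Longrightarrow> \<alpha> x \<in> Q" "\<And>x. x \<in> Q \<Longrightarrow> \<beta> x \<in> Q"
  shows "\<exists>n. \<forall>v \<in> back_core n V \<inter> Q. \<exists>z \<in> forward_part \<beta> V \<inter> Q.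
    inv z \<otimes> v \<in> forward_part \<alpha> (back_core n V)"
proof -
  have Vc: "V \<subseteq> carrier G" and Qc: "Q \<subseteq> carrier G"
    using V(1) Q(1) by (auto simp: subgroup.subset)
  define Z where "Z = forward_part \<beta> V \<inter> Q"
  have Z: "subgroup Z G"
    unfolding Z_def using swap.subgroup_forward_part[OF V(1)] Q(1) by (rule subgroups_Inter_pair)
  have Zc: "Z \<subseteq> carrier G" using Z by (simp add: subgroup.subset)
  have Zcl: "closedin T Z"
    unfolding Z_def
    using swap.closedin_forward_part[OF compactin_closed[OF V(3)]] Q(2) by (rule closedin_Int)
  have ZV: "Z \<subseteq> V" using forward_part_subset[of \<beta> V] by (auto simp: Z_def)
  have Zcomp: "compactin T Z" using closed_compactin[OF V(3) ZV Zcl] .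
  have Zback: "(\<beta> ^^ i) z \<in> Z" if "z \<in> Z" for z i
    using that
  proof (induction i)
    case (Suc i)
    then show ?case using Q(4) forward_part_step by (auto simp: Z_def)
  qed simp
  \<comment> \<open>Elements of \<open>W\<close> leave room for one more application of
    \<open>\<alpha>\<close>.\<close>
  define W where "W = V \<inter> {x \<in> carrier G. \<alpha> x \<in> V}"
  have W: "openin T W" "\<one> \<in> W"
    using V openin_preimage_iter[OF V(2), of 1] by (auto simp: W_def subgroup.one_closed)
  have "openin T (Z <#> W)" using openin_set_mult[OF W(1) Zc] .
  moreover have "x \<in> Z <#> W" if "x \<in> V \<inter> Q" "\<And>n. x \<in> back_core n V" for x
  proof -
    have "x \<in> Z" using that(1) that(2) by (auto simp: Z_def forward_part_def back_core_def)
    then show ?thesis using W(2) Zc unfolding set_mult_def by force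
  qed
  moreover have "compactin T (V \<inter> Q)"
    using closed_compactin[OF V(3) _ closedin_Int[OF compactin_closed[OF V(3)] Q(2)]] by blast
  \<comment> \<open>Inside \<open>Q\<close> the back cores decrease to \<open>Z\<close>, which the
    open set \<open>Z <#> W\<close> contains; compactness stops the sequence at a finite
    \<open>n\<close>.\<close>
  ultimately obtain n where n: "(V \<inter> Q) \<inter> back_core n V \<subseteq> Z <#> W"
    using compactin_nested_open[of T "V \<inter> Q" "\<lambda>n. back_core n V" "Z <#> W"]
      closedin_back_core[OF compactin_closed[OF V(3)]] back_core_Suc_subset by metis
  define A where "A = back_core n V"
  have A: "subgroup A G" "A \<subseteq> V" "A \<subseteq> carrier G" "closedin T A"
    using subgroup_back_core[OF V(1)] back_core_subset back_core_carrier
      closedin_back_core[OF compactin_closed[OF V(3)]] by (auto simp: A_def)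
  have ZA: "Z \<subseteq> A"
  proof
    fix z assume z: "z \<in> Z"
    then have "(\<beta> ^^ i) z \<in> V" for i using Zback ZV by blast
    then show "z \<in> A" using z Zc by (auto simp: A_def back_core_def)
  qed
  have step: "\<exists>z\<in>Z. inv z \<otimes> v \<in> A \<and> \<alpha> (inv z \<otimes> v) \<in> A" if v: "v \<in> A \<inter> Q" for v
  proof -
    have "v \<in> Z <#> W" using n v A(2) by (auto simp: A_def)
    then obtain z w where z: "z \<in> Z" "w \<in> W" "v = z \<otimes> w" by (auto simp: set_mult_def)
    have c: "z \<in> carrier G" "w \<in> carrier G" using z Zc by (auto simp: W_def)
    have w: "inv z \<otimes> v = w" using c z by simp
    have "w \<in> A"
      unfolding w[symmetric] using z(1) ZA v A(1) by (meson IntD1 subgroup.m_closed subgroup.m_inv_closed subsetD)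
    \<comment> \<open>Index 0 is what membership in \<open>W\<close> provides; a positive index of
      \<open>\<alpha> w\<close> is the previous index of \<open>w\<close>.\<close>
    have "(\<beta> ^^ i) (\<alpha> w) \<in> V" if "i \<le> n" for i
    proof (cases i)
      case 0
      then show ?thesis using z(2) by (simp add: W_def)
    next
      case (Suc j)
      then show ?thesis using \<open>w \<in> A\<close> c that by (simp add: A_def back_core_def funpow_swap1)
    qed
    then have "\<alpha> w \<in> A" using c by (simp add: A_def back_core_def)
    with \<open>w \<in> A\<close> w z(1) show ?thesis by metis
  qed
  have approx: "\<exists>z\<in>Z. \<forall>i\<le>k. (\<alpha> ^^ i) (inv z \<otimes> v) \<in> A" if v: "v \<in> A \<inter> Q" for v k
  proof (induction k)
    case 0
    show ?case using v A(3) subgroup.one_closed[OF Z] by (intro bexI[of _ \<one>]) auto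
  next
    case (Suc k)
    then obtain z where z: "z \<in> Z" "\<forall>i\<le>k. (\<alpha> ^^ i) (inv z \<otimes> v) \<in> A" by blast
    define w where "w = inv z \<otimes> v"
    have c: "z \<in> carrier G" "v \<in> carrier G" "w \<in> carrier G" using z v Zc A(3) by (auto simp: w_def)
    have "w \<in> Q" unfolding w_def using z v Q(1)
      by (auto simp: Z_def subgroup.m_closed subgroup.m_inv_closed)
    then have "(\<alpha> ^^ k) w \<in> Q" by (induction k) (auto simp: Q(3))
    moreover have "(\<alpha> ^^ k) w \<in> A" using z(2) by (simp add: w_def)
    ultimately obtain y where y: "y \<in> Z" "inv y \<otimes> (\<alpha> ^^ k) w \<in> A" "\<alpha> (inv y \<otimes> (\<alpha> ^^ k) w) \<in> A"
      using step by blast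
    have yc: "y \<in> carrier G" using y Zc by blast
    \<comment> \<open>The correction \<open>y\<close> needed at time \<open>k\<close> is transported
      back to time 0. Its images at times up to \<open>k\<close> lie on the backward orbit of
      \<open>y\<close>, so in \<open>Z\<close> and thus in \<open>A\<close>, and the conditions
      already achieved survive.\<close>
    define u where "u = (\<beta> ^^ k) y"
    have u: "u \<in> Z" "u \<in> carrier G" using Zback y(1) yc by (auto simp: u_def)
    have eq: "inv (z \<otimes> u) \<otimes> v = inv u \<otimes> w"
      using c u(2) by (simp add: inv_mult_group w_def m_assoc)
    have "(\<alpha> ^^ i) (inv u \<otimes> w) \<in> A" if "i \<le> Suc k" for i
    proof (cases "i = Suc k")
      case True
      then show ?thesis using y(3) yc c by (simp add: u_def)
    next
      case False
      then have "i \<le> k" using that by simp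
      then have "(\<alpha> ^^ i) u \<in> Z" using Zback y(1) yc by (simp add: u_def iter_cancel_le)
      then have "inv ((\<alpha> ^^ i) u) \<in> A" using ZA A(1) by (meson subgroup.m_inv_closed subsetD)
      moreover have "(\<alpha> ^^ i) w \<in> A" using z(2) \<open>i \<le> k\<close> by (simp add: w_def)
      ultimately show ?thesis using A(1) u(2) c by (simp add: subgroup.m_closed)
    qed
    moreover have "z \<otimes> u \<in> Z" using Z z(1) u(1) by (simp add: subgroup.m_closed)
    ultimately show ?case using eq by metis
  qed
  have "\<exists>z\<in>Z. inv z \<otimes> v \<in> forward_part \<alpha> A" if v: "v \<in> A \<inter> Q" for v
  proof -
    have vc: "v \<in> carrier G" using v A(3) by blast
    \<comment> \<open>The factor found so far depends on \<open>k\<close>; compactness of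
      \<open>Z\<close> provides one that serves all times.\<close>
    let ?C = "\<lambda>k. \<Inter>i\<in>{..k}. {z \<in> carrier G. (\<alpha> ^^ i) (inv z \<otimes> v) \<in> A}"
    have "\<exists>z\<in>Z. \<forall>k. z \<in> ?C k"
    proof (rule compactin_nested[OF Zcomp])
      show "closedin T (?C k)" for k
      proof (intro closedin_INT)
        fix i
        have "continuous_map T T (\<lambda>z. (\<alpha> ^^ i) (inv z \<otimes> v))"
          by (rule continuous_map_compose[OF _ continuous_iter[of i], of T "\<lambda>z. inv z \<otimes> v", unfolded o_def])
            (intro continuous_group_intros vc)
        then show "closedin T {z \<in> carrier G. (\<alpha> ^^ i) (inv z \<otimes> v) \<in> A}"
          using closedin_preimage A(4) by blast
      qed simp
      show "?C (Suc k) \<subseteq> ?C k" for k by auto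
      show "Z \<inter> ?C k \<noteq> {}" for k
      proof -
        obtain z where "z \<in> Z" "\<forall>i\<le>k. (\<alpha> ^^ i) (inv z \<otimes> v) \<in> A" using approx[OF v] by blast
        then have "z \<in> Z \<inter> ?C k" using Zc by auto
        then show ?thesis by blast
      qed
    qed
    then obtain z where "z \<in> Z" "\<forall>k. z \<in> ?C k" by blast
    then have "inv z \<otimes> v \<in> forward_part \<alpha> A" unfolding forward_part_def by blast
    with \<open>z \<in> Z\<close> show ?thesis by blast
  qed
  then show ?thesis by (auto simp: A_def Z_def)
qed

end

section \<open>Closures of contraction groups\<close>

context topological_automorphism
begin

lemma subgroup_closure_contraction: "subgroup (T closure_of contraction) G"
  using subgroup_closure_of[OF subgroup_contraction] .

lemma contraction_subset_closure: "contraction \<subseteq> T closure_of contraction"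
  using closure_of_subset[of contraction T] contraction_carrier by (simp add: topspace_eq)

lemma closure_contraction_forward:
  "x \<in> T closure_of contraction \<Longrightarrow> \<alpha> x \<in> T closure_of contraction"
  using closure_stable[OF contraction_carrier contraction_forward] .

lemma closure_contraction_backward:
  "x \<in> T closure_of contraction \<Longrightarrow> \<beta> x \<in> T closure_of contraction"
  using swap.closure_stable[OF contraction_carrier contraction_backward] .

lemma closure_contraction_iter_backward:
  "x \<in> T closure_of contraction \<Longrightarrow> (\<beta> ^^ n) x \<in> T closure_of contraction"
  by (induction n) (auto simp: closure_contraction_backward)

lemma closure_contraction_approx:
  assumes c: "c \<in> T closure_of contraction" and W: "subgroup W G" "openin T W"
  shows "\<exists>s\<in>contraction. inv s \<otimes> c \<in> W"
proof -
  obtain s where s: "s \<in> contraction" "s \<in> carrier G" "inv c \<otimes> s \<in> W"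
    using closure_approx[OF c W(2) subgroup.one_closed[OF W(1)]] by blast
  have "c \<in> carrier G" using closure_carrier c by blast
  then have "inv (inv c \<otimes> s) = inv s \<otimes> c" using s(2) by (simp add: inv_mult_group)
  then show ?thesis using s subgroup.m_inv_closed[OF W(1) s(3)] by auto
qed

lemma compactin_Int_closure:
  "compactin T W \<Longrightarrow> compactin T (W \<inter> T closure_of S)"
  using closed_compactin[of T W "W \<inter> T closure_of S"] compactin_closed[of W]
  by (simp add: closedin_Int)

text \<open>Modulo \<open>W\<close>, one application of \<open>\<alpha>\<close> moves \<open>W\<close> only by finitely many elements of the
  contraction group, and all later images of these return to \<open>W\<close>.\<close>

lemma forward_images_bounded:
  assumes W: "subgroup W G" "openin T W" "compactin T W"
  shows "\<exists>K. compactin T K \<and> (\<forall>n. \<forall>w \<in> W \<inter> T closure_of contraction. (\<alpha> ^^ n) w \<in> K)"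
proof -
  let ?C = "T closure_of contraction"
  note C = subgroup_closure_contraction
  have Wc: "W \<subseteq> carrier G" using W(1) by (simp add: subgroup.subset)
  have Cc: "?C \<subseteq> carrier G" by (rule closure_carrier)
  have "compactin T (\<alpha> ` (W \<inter> ?C))"
    using image_compactin[OF compactin_Int_closure[OF W(3)] continuous_forward] .
  moreover have "\<exists>s\<in>contraction. inv s \<otimes> k \<in> W" if k: "k \<in> \<alpha> ` (W \<inter> ?C)" for k
  proof (rule closure_contraction_approx[OF _ W(1,2)])
    show "k \<in> ?C" using k closure_contraction_forward by auto
  qed
  \<comment> \<open>Density of the contraction group in its closure allows the coset representatives
    to be contracted elements.\<close>
  ultimately obtain Y where Y: "finite Y" "Y \<subseteq> contraction"
      "\<forall>k\<in>\<alpha> ` (W \<inter> ?C). \<exists>s\<in>Y. inv s \<otimes> k \<in> W"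
    using finite_coset_cover[OF _ W(2) contraction_carrier] by metis
  have Yc: "Y \<subseteq> carrier G" and YC: "Y \<subseteq> ?C"
    using Y(2) contraction_carrier contraction_subset_closure by auto
  have "\<forall>y\<in>Y. \<exists>m. \<forall>n\<ge>m. (\<alpha> ^^ n) y \<in> W"
    using contractionD[OF _ W(2) subgroup.one_closed[OF W(1)]] Y(2) by auto
  then obtain m where m: "\<And>y n. \<lbrakk>y \<in> Y; n \<ge> m y\<rbrakk> \<Longrightarrow> (\<alpha> ^^ n) y \<in> W"
    by metis
  \<comment> \<open>The sum dominates each \<open>m y\<close>, so all of \<open>Y\<close> has
    returned to \<open>W\<close> from time \<open>N\<close> on.\<close>
  define N where "N = (\<Sum>y\<in>Y. m y)"
  have N: "(\<alpha> ^^ n) y \<in> W" if "y \<in> Y" "n \<ge> N" for y n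
    using m[OF that(1)] member_le_sum[of y Y m] that Y(1) by (simp add: N_def)
  define F where "F = rec_nat {\<one>} (\<lambda>n S. (\<alpha> ^^ n) ` Y <#> S)"
  have F0: "F 0 = {\<one>}" and FS: "F (Suc n) = (\<alpha> ^^ n) ` Y <#> F n" for n
    by (simp_all add: F_def)
  have Ffin: "finite (F n) \<and> F n \<subseteq> carrier G" for n
  proof (induction n)
    case (Suc n)
    have "(\<alpha> ^^ n) ` Y \<subseteq> carrier G" using Yc by auto
    moreover have "F (Suc n) = (\<lambda>(a, b). a \<otimes> b) ` ((\<alpha> ^^ n) ` Y \<times> F n)"
      unfolding FS by (auto simp: set_mult_def)
    ultimately show ?case
      using Suc Y(1) set_mult_closed[of "(\<alpha> ^^ n) ` Y" "F n"] by (simp add: FS)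
  qed (simp add: F0)
  have orbit: "(\<alpha> ^^ n) w \<in> F n <#> W" if "w \<in> W \<inter> ?C" for n w
    using that
  proof (induction n arbitrary: w)
    case 0
    then have "\<one> \<otimes> w \<in> F 0 <#> W" unfolding F0 set_mult_def by blast
    then show ?case using 0 Wc by (simp add: subset_iff)
  next
    case (Suc n)
    then obtain y where y: "y \<in> Y" "inv y \<otimes> \<alpha> w \<in> W" using Y(3) by blast
    have c: "y \<in> carrier G" "w \<in> carrier G" using y(1) Yc Suc.prems Wc by auto
    have "inv y \<otimes> \<alpha> w \<in> ?C"
      using C y(1) YC closure_contraction_forward Suc.prems
      by (meson IntD2 subgroup.m_closed subgroup.m_inv_closed subsetD)
    with y(2) have "(\<alpha> ^^ n) (inv y \<otimes> \<alpha> w) \<in> F n <#> W" using Suc.IH by blast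
    then obtain f v where f: "f \<in> F n" "v \<in> W" "(\<alpha> ^^ n) (inv y \<otimes> \<alpha> w) = f \<otimes> v"
      by (auto simp: set_mult_def)
    have fc: "f \<in> carrier G" "v \<in> carrier G" using f Ffin[of n] Wc by auto
    have "(\<alpha> ^^ Suc n) w = (\<alpha> ^^ n) (y \<otimes> (inv y \<otimes> \<alpha> w))"
      using c by (simp add: funpow_swap1)
    also have "\<dots> = (\<alpha> ^^ n) y \<otimes> (f \<otimes> v)"
      using c f(3) by (subst iter_mult) simp_all
    also have "\<dots> = ((\<alpha> ^^ n) y \<otimes> f) \<otimes> v" using c fc by (simp add: m_assoc)
    finally show ?case
      using y(1) f(1,2) unfolding FS set_mult_def by blast
  qed
  define E where "E = (\<Union>i\<in>{..N}. F i)"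
  have E: "finite E" "E \<subseteq> carrier G" using Ffin by (auto simp: E_def)
  \<comment> \<open>From time \<open>N\<close> on, each new factor on the left lies in
    \<open>W\<close> and is absorbed there, so \<open>F 0\<close> to \<open>F N\<close> bound all
    later sets.\<close>
  have FE: "F n \<subseteq> W <#> E" for n
  proof (induction n)
    case 0
    have "\<one> \<in> E" using F0 by (auto simp: E_def)
    then have "\<one> \<otimes> \<one> \<in> W <#> E"
      using subgroup.one_closed[OF W(1)] unfolding set_mult_def by blast
    then show ?case by (simp add: F0)
  next
    case (Suc n)
    show ?case
    proof (cases "n < N")
      case True
      show ?thesis
      proof
        fix f assume f: "f \<in> F (Suc n)"
        then have "f \<in> E" using True by (auto simp: E_def intro!: bexI[of _ "Suc n"])
        then have "\<one> \<otimes> f \<in> W <#> E"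
          using subgroup.one_closed[OF W(1)] unfolding set_mult_def by blast
        then show "f \<in> W <#> E" using f Ffin[of "Suc n"] by (simp add: subset_iff)
      qed
    next
      case False
      show ?thesis
      proof
        fix f assume "f \<in> F (Suc n)"
        then obtain y g where y: "y \<in> Y" "g \<in> F n" "f = (\<alpha> ^^ n) y \<otimes> g"
          by (auto simp: FS set_mult_def)
        have "g \<in> W <#> E" using Suc y(2) by (rule subsetD)
        then obtain w e where w: "w \<in> W" "e \<in> E" "g = w \<otimes> e" by (auto simp: set_mult_def)
        have yW: "(\<alpha> ^^ n) y \<in> W" using N[OF y(1)] False by simp
        have "f = ((\<alpha> ^^ n) y \<otimes> w) \<otimes> e"
          using w yW Wc E(2) y(3) by (simp add: m_assoc subset_iff)
        moreover have "(\<alpha> ^^ n) y \<otimes> w \<in> W" using yW w(1) W(1) by (simp add: subgroup.m_closed)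
        ultimately show "f \<in> W <#> E" using w(2) unfolding set_mult_def by blast
      qed
    qed
  qed
  have "compactin T E" using E by (intro finite_imp_compactin) (simp_all add: topspace_eq)
  then have "compactin T ((W <#> E) <#> W)" using W(3) by (intro compactin_set_mult)
  moreover have "(\<alpha> ^^ n) w \<in> (W <#> E) <#> W" if "w \<in> W \<inter> ?C" for n w
    using subsetD[OF mono_set_mult[OF FE subset_refl] orbit[OF that]] .
  ultimately show ?thesis by blast
qed

text \<open>\<open>R\<close> is the increasing union of the images of
  \<open>forward_part \<beta> V \<inter> T closure_of contraction\<close> under the iterates of
  \<open>\<alpha>\<close>. It is invariant in both directions, and
  \<open>forward_images_bounded\<close> keeps it in a compact set, so its closure can serve as
  \<open>P\<close>.\<close>

lemma bounded_expanding_part: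
  assumes V: "subgroup V G" "openin T V" "compactin T V"
  shows "\<exists>P. subgroup P G \<and> compactin T P \<and> P \<subseteq> T closure_of contraction
    \<and> (\<forall>x\<in>P. \<alpha> x \<in> P) \<and> (\<forall>x\<in>P. \<beta> x \<in> P)
    \<and> forward_part \<beta> V \<inter> T closure_of contraction \<subseteq> P"
proof -
  let ?C = "T closure_of contraction"
  note C = subgroup_closure_contraction
  have Cc: "?C \<subseteq> carrier G" by (rule closure_carrier)
  let ?Z = "forward_part \<beta> V"
  have Z: "subgroup ?Z G" using swap.subgroup_forward_part[OF V(1)] .
  define R where "R = {v \<in> ?C. \<exists>n. (\<beta> ^^ n) v \<in> ?Z}"
  have RC: "R \<subseteq> ?C" by (auto simp: R_def)
  then have Rc: "R \<subseteq> carrier G" using Cc by (rule subset_trans)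
  have later: "(\<beta> ^^ k) v \<in> ?Z" if "(\<beta> ^^ n) v \<in> ?Z" "n \<le> k" for v n k
    using forward_part_steps[OF that(1), of "k - n"] that(2) by (simp add: swap.iter_iter)
  have R: "subgroup R G"
  proof (rule subgroupI)
    have "\<one> \<in> R" using subgroup.one_closed[OF C] subgroup.one_closed[OF Z] by (simp add: R_def)
    then show "R \<noteq> {}" by blast
    show "inv a \<in> R" if a: "a \<in> R" for a
    proof -
      obtain n where n: "(\<beta> ^^ n) a \<in> ?Z" using a by (auto simp: R_def)
      have "a \<in> carrier G" using a Rc by (rule rev_subsetD)
      then have "(\<beta> ^^ n) (inv a) \<in> ?Z" using subgroup.m_inv_closed[OF Z n] by simp
      then show ?thesis using a subgroup.m_inv_closed[OF C] by (auto simp: R_def)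
    qed
    show "a \<otimes> b \<in> R" if a: "a \<in> R" and b: "b \<in> R" for a b
    proof -
      obtain m n where n: "(\<beta> ^^ m) a \<in> ?Z" "(\<beta> ^^ n) b \<in> ?Z"
        using a b by (auto simp: R_def)
      have c: "a \<in> carrier G" "b \<in> carrier G" using a b Rc by auto
      have "(\<beta> ^^ (max m n)) (a \<otimes> b) \<in> ?Z"
        using subgroup.m_closed[OF Z later[OF n(1)] later[OF n(2)], of "max m n" "max m n"] c by simp
      then show ?thesis using a b subgroup.m_closed[OF C] by (auto simp: R_def)
    qed
  qed (rule Rc)
  obtain K where K: "compactin T K" "\<And>n w. w \<in> V \<inter> ?C \<Longrightarrow> (\<alpha> ^^ n) w \<in> K"
    using forward_images_bounded[OF V] by blast
  have RK: "R \<subseteq> K"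
  proof
    fix v assume v: "v \<in> R"
    then obtain n where n: "(\<beta> ^^ n) v \<in> ?Z" by (auto simp: R_def)
    have "(\<beta> ^^ n) v \<in> V \<inter> ?C"
      using subsetD[OF forward_part_subset n] closure_contraction_iter_backward v by (auto simp: R_def)
    then have "(\<alpha> ^^ n) ((\<beta> ^^ n) v) \<in> K" by (rule K(2))
    then show "v \<in> K" using v Rc by (simp add: subset_iff)
  qed
  let ?P = "T closure_of R"
  have "?P \<subseteq> K" using closure_of_minimal[OF RK compactin_closed[OF K(1)]] .
  then have Pcomp: "compactin T ?P" using closed_compactin[OF K(1)] by simp
  have PC: "?P \<subseteq> ?C" using closure_of_minimal[OF RC] by simp
  have "\<alpha> x \<in> R" if x: "x \<in> R" for x
  proof -
    obtain n where n: "(\<beta> ^^ n) x \<in> ?Z" using x by (auto simp: R_def)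
    have "x \<in> carrier G" using x Rc by (rule rev_subsetD)
    then have "(\<beta> ^^ Suc n) (\<alpha> x) \<in> ?Z" using n by (simp add: funpow_Suc_right del: funpow.simps)
    then show ?thesis using x closure_contraction_forward by (auto simp: R_def simp del: funpow.simps)
  qed
  then have Pa: "\<forall>x\<in>?P. \<alpha> x \<in> ?P" using closure_stable[OF Rc] by blast
  have "\<beta> x \<in> R" if x: "x \<in> R" for x
  proof -
    obtain n where n: "(\<beta> ^^ n) x \<in> ?Z" using x by (auto simp: R_def)
    have "(\<beta> ^^ n) (\<beta> x) \<in> ?Z" using forward_part_step[OF n] by (simp add: funpow_swap1)
    then show ?thesis using x closure_contraction_backward by (auto simp: R_def)
  qed
  then have Pb: "\<forall>x\<in>?P. \<beta> x \<in> ?P" using swap.closure_stable[OF Rc] by blast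
  have "?Z \<inter> ?C \<subseteq> R" by (auto simp: R_def intro!: exI[of _ 0])
  also have "R \<subseteq> ?P" using closure_of_subset[of R T] Rc by (simp add: topspace_eq)
  finally show ?thesis using subgroup_closure_of[OF R] Pcomp PC Pa Pb by blast
qed

text \<open>Tidying a suitable \<open>W\<close> leaves only an expanding factor that might escape
  under \<open>\<alpha>\<close>, and that factor lies in the compact invariant group
  \<open>P\<close>. So \<open>M = P B\<close>, with \<open>B\<close> a compact open subgroup of the
  closure normalised by \<open>P\<close>, is mapped into itself.\<close>

lemma contracting_compact_open_subgroup:
  "\<exists>M N. subgroup M G \<and> compactin T M \<and> M \<subseteq> T closure_of contraction \<and> (\<forall>x\<in>M. \<alpha> x \<in> M)
    \<and> openin T N \<and> subgroup N G \<and> N \<inter> T closure_of contraction \<subseteq> M"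
proof -
  let ?C = "T closure_of contraction"
  note C = subgroup_closure_contraction
  have Cc: "?C \<subseteq> carrier G" by (rule closure_carrier)
  have "openin T (carrier G)" using openin_topspace[of T] by (simp add: topspace_eq)
  then obtain V where V: "subgroup V G" "openin T V" "compactin T V"
    using small_subgroups by blast
  obtain P where P: "subgroup P G" "compactin T P" "P \<subseteq> ?C" "\<And>x. x \<in> P \<Longrightarrow> \<alpha> x \<in> P"
      "\<And>x. x \<in> P \<Longrightarrow> \<beta> x \<in> P" "forward_part \<beta> V \<inter> ?C \<subseteq> P"
    using bounded_expanding_part[OF V] by blast
  have Pc: "P \<subseteq> carrier G" using P(1) by (simp add: subgroup.subset)
  have Piter: "(\<beta> ^^ i) p \<in> P" if "p \<in> P" for i p using that by (induction i) (auto simp: P(5))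
  \<comment> \<open>The largest subset of \<open>V\<close> that is invariant under conjugation by
    \<open>P\<close>; compactness of \<open>P\<close> makes it open.\<close>
  define W where "W = {x \<in> carrier G. \<forall>k\<in>P. k \<otimes> x \<otimes> inv k \<in> V}"
  have Wop: "openin T W" unfolding W_def using openin_conj_core[OF P(2) V(1,2)] .
  have WV: "W \<subseteq> V"
  proof
    fix x assume "x \<in> W"
    then have "\<one> \<otimes> x \<otimes> inv \<one> \<in> V" "x \<in> carrier G"
      using subgroup.one_closed[OF P(1)] unfolding W_def by blast+
    then show "x \<in> V" by simp
  qed
  have Wsub: "subgroup W G"
  proof (rule subgroupI)
    have "\<one> \<in> W" using Pc V(1) by (auto simp: W_def subgroup.one_closed subset_iff)
    then show "W \<noteq> {}" by blast
    show "inv a \<in> W" if a: "a \<in> W" for a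
    proof -
      have "k \<otimes> inv a \<otimes> inv k = inv (k \<otimes> a \<otimes> inv k)" if "k \<in> P" for k
        using that a Pc by (simp add: W_def inv_mult_group m_assoc subset_iff)
      then show ?thesis using a V(1) by (simp add: W_def subgroup.m_inv_closed)
    qed
    show "a \<otimes> b \<in> W" if ab: "a \<in> W" "b \<in> W" for a b
    proof -
      have "k \<otimes> (a \<otimes> b) \<otimes> inv k = (k \<otimes> a \<otimes> inv k) \<otimes> (k \<otimes> b \<otimes> inv k)" if "k \<in> P" for k
        using that ab Pc by (simp add: W_def m_assoc subset_iff)
      then show ?thesis using ab V(1) by (simp add: W_def subgroup.m_closed)
    qed
  qed (auto simp: W_def)
  have Wcomp: "compactin T W"
    using closed_compactin[OF V(3) WV closedin_open_subgroup[OF Wsub Wop]] .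
  have Wconj: "p \<otimes> x \<otimes> inv p \<in> W" if "p \<in> P" "x \<in> W" for p x
  proof -
    have c: "p \<in> carrier G" "x \<in> carrier G" using that Pc by (auto simp: W_def)
    have "k \<otimes> (p \<otimes> x \<otimes> inv p) \<otimes> inv k \<in> V" if k: "k \<in> P" for k
    proof -
      have "(k \<otimes> p) \<otimes> x \<otimes> inv (k \<otimes> p) \<in> V"
        using subgroup.m_closed[OF P(1) k \<open>p \<in> P\<close>] \<open>x \<in> W\<close> by (simp add: W_def)
      moreover have "k \<in> carrier G" using k Pc by (rule rev_subsetD)
      ultimately show ?thesis using c by (simp add: inv_mult_group m_assoc)
    qed
    then show ?thesis using c by (simp add: W_def)
  qed
  obtain n where n: "\<And>v. v \<in> back_core n W \<inter> ?C \<Longrightarrow> \<exists>z \<in> forward_part \<beta> W \<inter> ?C.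
      inv z \<otimes> v \<in> forward_part \<alpha> (back_core n W)"
    using tidy_above[OF Wsub Wop Wcomp C closedin_closure_of
        closure_contraction_forward closure_contraction_backward] by blast
  define A where "A = back_core n W"
  have A: "subgroup A G" "openin T A" "compactin T A" "A \<subseteq> carrier G"
    using subgroup_back_core[OF Wsub] openin_back_core[OF Wop] compactin_back_core[OF Wcomp]
      back_core_carrier by (auto simp: A_def)
  \<comment> \<open>Since \<open>\<beta>\<close> maps \<open>P\<close> into itself, \<open>P\<close>
    still normalises the back core of \<open>W\<close>.\<close>
  have Aconj: "p \<otimes> x \<otimes> inv p \<in> A" if "p \<in> P" "x \<in> A" for p x
    unfolding A_def back_core_def
  proof (intro CollectI conjI allI impI)
    have c: "p \<in> carrier G" "x \<in> carrier G" using that Pc A(4) by auto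
    then show "p \<otimes> x \<otimes> inv p \<in> carrier G" by simp
    fix i assume "i \<le> n"
    then have "(\<beta> ^^ i) x \<in> W" using that(2) by (simp add: A_def back_core_def)
    from Wconj[OF Piter[OF that(1)] this, of i]
    show "(\<beta> ^^ i) (p \<otimes> x \<otimes> inv p) \<in> W" using c by simp
  qed
  define B where "B = A \<inter> ?C"
  have B: "subgroup B G" unfolding B_def using A(1) C by (rule subgroups_Inter_pair)
  have Bc: "B \<subseteq> carrier G" using A(4) by (auto simp: B_def)
  have Bcomp: "compactin T B" unfolding B_def by (rule compactin_Int_closure[OF A(3)])
  have Bconj: "p \<otimes> x \<otimes> inv p \<in> B" if "p \<in> P" "x \<in> B" for p x
  proof -
    have "p \<in> ?C" "x \<in> ?C" using that P(3) by (auto simp: B_def)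
    then have "p \<otimes> x \<otimes> inv p \<in> ?C" using C by (meson subgroup.m_closed subgroup.m_inv_closed)
    then show ?thesis using Aconj that by (simp add: B_def)
  qed
  define M where "M = P <#> B"
  have MI: "p \<otimes> b \<in> M" if "p \<in> P" "b \<in> B" for p b
    using that unfolding M_def set_mult_def by blast
  have ME: "\<exists>p b. p \<in> P \<and> b \<in> B \<and> x = p \<otimes> b \<and> p \<in> carrier G \<and> b \<in> carrier G" if "x \<in> M" for x
    using that Pc Bc unfolding M_def set_mult_def by blast
  have M: "subgroup M G"
  proof (rule subgroupI)
    show "M \<subseteq> carrier G" unfolding M_def using Pc Bc by (rule set_mult_closed)
    show "M \<noteq> {}" using MI[OF subgroup.one_closed[OF P(1)] subgroup.one_closed[OF B]] by blast
    show "inv a \<in> M" if "a \<in> M" for a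
    proof -
      obtain p b where p: "p \<in> P" "b \<in> B" "a = p \<otimes> b" "p \<in> carrier G" "b \<in> carrier G"
        using ME[OF \<open>a \<in> M\<close>] by blast
      have "inv p \<otimes> (p \<otimes> inv b \<otimes> inv p) \<in> M"
        using MI Bconj p(1,2) P(1) B by (simp add: subgroup.m_inv_closed)
      also have "inv p \<otimes> (p \<otimes> inv b \<otimes> inv p) = inv a"
        using p(3-5) by (simp add: m_assoc inv_mult_group)
      finally show ?thesis .
    qed
    show "a \<otimes> a' \<in> M" if "a \<in> M" "a' \<in> M" for a a'
    proof -
      obtain p b where p: "p \<in> P" "b \<in> B" "a = p \<otimes> b" "p \<in> carrier G" "b \<in> carrier G"
        using ME[OF \<open>a \<in> M\<close>] by blast
      obtain q d where q: "q \<in> P" "d \<in> B" "a' = q \<otimes> d" "q \<in> carrier G" "d \<in> carrier G"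
        using ME[OF \<open>a' \<in> M\<close>] by blast
      have "inv q \<otimes> b \<otimes> inv (inv q) \<in> B" using Bconj q(1) p(2) P(1) by (simp add: subgroup.m_inv_closed)
      then have "inv q \<otimes> b \<otimes> inv (inv q) \<otimes> d \<in> B" using q(2) B by (simp add: subgroup.m_closed)
      then have "(p \<otimes> q) \<otimes> (inv q \<otimes> b \<otimes> inv (inv q) \<otimes> d) \<in> M"
        using MI p(1) q(1) P(1) by (simp add: subgroup.m_closed)
      also have "(p \<otimes> q) \<otimes> (inv q \<otimes> b \<otimes> inv (inv q) \<otimes> d) = a \<otimes> a'"
        using p(3-5) q(3-5) by (simp add: m_assoc)
      finally show ?thesis .
    qed
  qed
  have Mcomp: "compactin T M" unfolding M_def by (rule compactin_set_mult[OF P(2) Bcomp])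
  have MC: "M \<subseteq> ?C"
  proof
    fix x assume "x \<in> M"
    then obtain p b where "p \<in> P" "b \<in> B" "x = p \<otimes> b" using ME by blast
    then show "x \<in> ?C" using P(3) subgroup.m_closed[OF C] by (auto simp: B_def)
  qed
  have Ma: "\<alpha> x \<in> M" if xM: "x \<in> M" for x
  proof -
    obtain p b where p: "p \<in> P" "b \<in> B" "x = p \<otimes> b" "p \<in> carrier G" "b \<in> carrier G"
      using ME[OF xM] by blast
    obtain z where z: "z \<in> forward_part \<beta> W" "z \<in> ?C" "inv z \<otimes> b \<in> forward_part \<alpha> A"
      \<comment> \<open>The factor \<open>z\<close> of \<open>b\<close> has its backward orbit in
        \<open>W\<close>, hence in \<open>V\<close>, and is absorbed into \<open>P\<close>; the
        other factor is mapped into \<open>B\<close>.\<close>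
      using n[of b] p(2) by (auto simp: A_def B_def)
    have zP: "z \<in> P" using z subsetD[OF forward_part_mono[OF WV] z(1)] P(6) by blast
    then have zc: "z \<in> carrier G" using Pc by blast
    have "inv z \<otimes> b \<in> ?C"
      using z(2) p(2) C by (simp add: B_def subgroup.m_closed subgroup.m_inv_closed)
    then have "\<alpha> (inv z \<otimes> b) \<in> B"
      using forward_partD[OF z(3), of 1] closure_contraction_forward by (simp add: B_def)
    moreover have "\<alpha> (p \<otimes> z) \<in> P" using P(1,4) p(1) zP by (simp add: subgroup.m_closed)
    ultimately have "\<alpha> (p \<otimes> z) \<otimes> \<alpha> (inv z \<otimes> b) \<in> M" by (intro MI)
    also have "\<alpha> (p \<otimes> z) \<otimes> \<alpha> (inv z \<otimes> b) = \<alpha> x"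
      using p(3-5) zc by (simp add: m_assoc)
    finally show ?thesis .
  qed
  have "B \<subseteq> M"
  proof
    fix b assume "b \<in> B"
    then have "\<one> \<otimes> b \<in> M" by (intro MI subgroup.one_closed[OF P(1)])
    then show "b \<in> M" using \<open>b \<in> B\<close> Bc by (simp add: subset_iff)
  qed
  then show ?thesis using M Mcomp MC Ma A(1,2) unfolding B_def by blast
qed

text \<open>The infinite product \<open>c \<alpha>(c) \<alpha>\<^sup>2(c) \<dots>\<close> solves the equation; compactness replaces its convergence.\<close>

lemma solve_twisted_conjugacy:
  assumes c: "c \<in> contraction" and M: "subgroup M G" "compactin T M" "\<And>n. (\<alpha> ^^ n) c \<in> M"
  shows "\<exists>u\<in>M. c = u \<otimes> inv (\<alpha> u)"
proof -
  have Mc: "M \<subseteq> carrier G" using M(1) by (simp add: subgroup.subset)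
  have cc: "c \<in> carrier G" using c contraction_carrier by blast
  \<comment> \<open>The partial products; \<open>u n\<close> contains the factors at times below
    \<open>n\<close>, so that \<open>c \<otimes> \<alpha> (u n)\<close> is the next partial
    product.\<close>
  define u where "u = rec_nat \<one> (\<lambda>n y. y \<otimes> (\<alpha> ^^ n) c)"
  have u0: "u 0 = \<one>" and uS: "u (Suc n) = u n \<otimes> (\<alpha> ^^ n) c" for n by (simp_all add: u_def)
  have uM: "u n \<in> M" for n
    by (induction n) (simp_all add: u0 uS M(1,3) subgroup.one_closed subgroup.m_closed)
  then have uc: "u n \<in> carrier G" for n using Mc by blast
  have rec: "c \<otimes> \<alpha> (u n) = u (Suc n)" for n
  proof (induction n)
    case (Suc n)
    have "c \<otimes> \<alpha> (u (Suc n)) = (c \<otimes> \<alpha> (u n)) \<otimes> (\<alpha> ^^ Suc n) c"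
      unfolding uS[of n] using uc[of n] cc by (simp add: m_assoc)
    then show ?case using Suc by (simp only: uS[of "Suc n"])
  qed (use cc in \<open>simp add: u0 uS\<close>)
  let ?f = "\<lambda>v. inv v \<otimes> (c \<otimes> \<alpha> v)"
  have fu: "?f (u n) = (\<alpha> ^^ n) c" for n
    unfolding rec uS using uc cc by simp
  have "continuous_map T T ?f"
    by (intro continuous_group_intros continuous_forward cc)
  then have "closedin T (?f ` M)" using compactin_closed image_compactin[OF M(2)] by blast
  then have op: "openin T (carrier G - ?f ` M)"
    by (metis openin_closedin_eq openin_diff openin_topspace topspace_eq)
  have "\<one> \<in> ?f ` M"
  proof (rule ccontr)
    assume "\<not> ?thesis"
    then obtain m where "\<forall>n\<ge>m. (\<alpha> ^^ n) c \<in> carrier G - ?f ` M"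
      using contractionD[OF c op] by blast
    then have "?f (u m) \<notin> ?f ` M" unfolding fu by blast
    then show False using uM by blast
  qed
  then obtain v where v: "v \<in> M" "\<one> = inv v \<otimes> (c \<otimes> \<alpha> v)" by blast
  have vc: "v \<in> carrier G" using v Mc by blast
  have "v = v \<otimes> (inv v \<otimes> (c \<otimes> \<alpha> v))" unfolding v(2)[symmetric] using vc by simp
  also have "\<dots> = c \<otimes> \<alpha> v" using vc cc by simp
  finally have "v \<otimes> inv (\<alpha> v) = c" using vc cc by (metis inv_solve_right step_closed)
  then show ?thesis using v(1) by blast
qed

theorem closure_contraction_subset:
  assumes D: "subgroup D G" "\<And>x. x \<in> D \<Longrightarrow> \<beta> x \<in> D"
    and U: "subgroup U G" "openin T U"
    and UD: "\<And>u. \<lbrakk>u \<in> U; u \<in> T closure_of contraction\<rbrakk> \<Longrightarrow> u \<otimes> inv (\<alpha> u) \<in> D"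
  shows "T closure_of contraction \<subseteq> D"
proof -
  let ?C = "T closure_of contraction"
  note C = subgroup_closure_contraction
  have Cc: "?C \<subseteq> carrier G" by (rule closure_carrier)
  have conD: "c \<in> D" if c: "c \<in> contraction" for c
  proof -
    obtain V where V: "subgroup V G" "openin T V" "compactin T V" "V \<subseteq> U"
      using small_subgroups[OF U(2) subgroup.one_closed[OF U(1)]] by blast
    obtain m where m: "\<forall>n\<ge>m. (\<alpha> ^^ n) c \<in> V"
      using contractionD[OF c V(2) subgroup.one_closed[OF V(1)]] by blast
    \<comment> \<open>Solving for a late iterate keeps the solution in \<open>V\<close> and hence in
      \<open>U\<close>; invariance of \<open>D\<close> under \<open>\<beta>\<close> then brings the
      conclusion back to \<open>c\<close>.\<close>
    define d where "d = (\<alpha> ^^ m) c"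
    have "d \<in> contraction" using contraction_iter[OF c] by (simp add: d_def)
    moreover have "subgroup (V \<inter> ?C) G" using V(1) C by (rule subgroups_Inter_pair)
    moreover have "compactin T (V \<inter> ?C)" by (rule compactin_Int_closure[OF V(3)])
    moreover have "(\<alpha> ^^ n) d \<in> V \<inter> ?C" for n
      using m contraction_iter[OF \<open>d \<in> contraction\<close>] contraction_subset_closure
      by (auto simp: d_def iter_iter)
    ultimately obtain u where "u \<in> V \<inter> ?C" "d = u \<otimes> inv (\<alpha> u)"
      using solve_twisted_conjugacy by blast
    then have "d \<in> D" using UD V(4) by blast
    then have "(\<beta> ^^ m) d \<in> D" by (induction m) (auto simp: D(2))
    then show ?thesis using c contraction_carrier by (auto simp: d_def)
  qed
  \<comment> \<open>With \<open>f u = u \<otimes> inv (\<alpha> u)\<close>, the rule \<open>f (s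
    \<otimes> r) = s \<otimes> f r \<otimes> inv (\<alpha> s)\<close> carries the commutator
    condition from \<open>U\<close> to the whole closure: \<open>r\<close> is taken in
    \<open>U\<close> and \<open>s\<close> in the contraction group, already known to lie in
    \<open>D\<close>.\<close>
  have phiD: "m \<otimes> inv (\<alpha> m) \<in> D" if m: "m \<in> ?C" for m
  proof -
    obtain s where s: "s \<in> contraction" "inv s \<otimes> m \<in> U"
      using closure_contraction_approx[OF m U] by blast
    have c: "s \<in> carrier G" "m \<in> carrier G" using s(1) contraction_carrier m Cc by auto
    have "inv s \<otimes> m \<in> ?C"
      using C s(1) contraction_subset_closure m by (meson subgroup.m_closed subgroup.m_inv_closed subsetD)
    then have "(inv s \<otimes> m) \<otimes> inv (\<alpha> (inv s \<otimes> m)) \<in> D" using UD s(2) by blast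
    moreover have "s \<in> D" "inv (\<alpha> s) \<in> D"
      using conD s(1) contraction_forward D(1) by (auto simp: subgroup.m_inv_closed)
    ultimately have "s \<otimes> ((inv s \<otimes> m) \<otimes> inv (\<alpha> (inv s \<otimes> m))) \<otimes> inv (\<alpha> s) \<in> D"
      using D(1) by (simp add: subgroup.m_closed)
    also have "s \<otimes> ((inv s \<otimes> m) \<otimes> inv (\<alpha> (inv s \<otimes> m))) \<otimes> inv (\<alpha> s) = m \<otimes> inv (\<alpha> m)"
      using c by (simp add: inv_mult_group m_assoc)
    finally show ?thesis .
  qed
  obtain M N where M: "subgroup M G" "compactin T M" "M \<subseteq> ?C" "\<And>x. x \<in> M \<Longrightarrow> \<alpha> x \<in> M"
      and N: "openin T N" "subgroup N G" "N \<inter> ?C \<subseteq> M"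
    using contracting_compact_open_subgroup by blast
  let ?f = "\<lambda>u. u \<otimes> inv (\<alpha> u)"
  have "continuous_map T T ?f" by (intro continuous_group_intros continuous_forward)
  then have "closedin T (?f ` M)" using compactin_closed image_compactin[OF M(2)] by blast
  then have op: "openin T (N - ?f ` M)" using N(1) by (rule openin_diff[rotated])
  have conM: "c \<in> ?f ` M" if "c \<in> contraction" "c \<in> M" for c
  proof -
    have "(\<alpha> ^^ n) c \<in> M" for n using that(2) by (induction n) (auto simp: M(4))
    then show ?thesis using solve_twisted_conjugacy[OF that(1) M(1,2)] by blast
  qed
  \<comment> \<open>A point of \<open>N\<close> in the closure but outside the closed set
    \<open>?f\<close> M\<open>would have contracted elements near it that are outside too, although
    all contracted elements of\<close>M\<open>lie in\<close>?f \<open>M\<close>.\<close>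
  have ND: "a \<in> D" if a: "a \<in> N \<inter> ?C" for a
  proof (cases "a \<in> ?f ` M")
    case True
    then show ?thesis using phiD M(3) by blast
  next
    case False
    then have "a \<in> N - ?f ` M" using a by blast
    moreover have "a \<in> ?C" using a by blast
    ultimately obtain c where "c \<in> contraction" "c \<in> N - ?f ` M"
      using op unfolding in_closure_of by meson
    then have False using conM N(3) contraction_subset_closure by blast
    then show ?thesis ..
  qed
  show ?thesis
  proof
    fix c assume c: "c \<in> ?C"
    obtain s where s: "s \<in> contraction" "inv s \<otimes> c \<in> N"
      using closure_contraction_approx[OF c N(2,1)] by blast
    have cc: "s \<in> carrier G" "c \<in> carrier G" using s(1) contraction_carrier c Cc by auto
    have "inv s \<otimes> c \<in> ?C"
      using C s(1) contraction_subset_closure c by (meson subgroup.m_closed subgroup.m_inv_closed subsetD)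
    then have "inv s \<otimes> c \<in> D" using s(2) ND by blast
    then have "s \<otimes> (inv s \<otimes> c) \<in> D" using conD[OF s(1)] D(1) by (simp add: subgroup.m_closed)
    then show "c \<in> D" using cc by simp
  qed
qed

end

section \<open>Attraction to a compact invariant subgroup\<close>

text \<open>A finite subfamily of a chain has a least member, so the finite intersection property
  applies. Chains of arbitrary length are needed because no countable base at \<open>\<one>\<close>
  is assumed.\<close>

lemma compactin_chain:
  assumes K: "compactin T K" "K \<noteq> {}" and clo: "\<And>C. C \<in> \<C> \<Longrightarrow> closedin T C"
    and chain: "\<And>C D. \<lbrakk>C \<in> \<C>; D \<in> \<C>\<rbrakk> \<Longrightarrow> C \<subseteq> D \<or> D \<subseteq> C"
    and ne: "\<And>C. C \<in> \<C> \<Longrightarrow> K \<inter> C \<noteq> {}"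
  shows "\<exists>x\<in>K. \<forall>C\<in>\<C>. x \<in> C"
proof -
  have least: "\<F> = {} \<or> (\<exists>M\<in>\<F>. \<forall>C\<in>\<F>. M \<subseteq> C)" if "finite \<F>" "\<F> \<subseteq> \<C>" for \<F>
    using that
  proof (induction rule: finite_induct)
    case (insert C \<F>)
    then consider "\<F> = {}" | M where "M \<in> \<F>" "\<forall>C\<in>\<F>. M \<subseteq> C" by auto
    then show ?case
    proof cases
      case 2
      then have "M \<subseteq> C \<or> C \<subseteq> M" using chain[of M C] insert.prems by blast
      then show ?thesis using 2 by (metis insert_iff order_trans subset_refl)
    qed simp
  qed simp
  have "K \<inter> \<Inter>\<F> \<noteq> {}" if \<F>: "finite \<F>" "\<F> \<subseteq> \<C>" for \<F>
  proof (cases "\<F> = {}")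
    case False
    then obtain M where M: "M \<in> \<F>" "\<forall>C\<in>\<F>. M \<subseteq> C" using least[OF \<F>] by blast
    then have "K \<inter> M \<noteq> {}" using ne \<F>(2) by blast
    then show ?thesis using M(2) by blast
  qed (use K(2) in simp)
  moreover have "(\<forall>C\<in>\<C>. closedin T C) \<and>
      (\<forall>\<F>. finite \<F> \<and> \<F> \<subseteq> \<C> \<longrightarrow> K \<inter> \<Inter>\<F> \<noteq> {}) \<longrightarrow> K \<inter> \<Inter>\<C> \<noteq> {}"
    using K(1) unfolding compactin_fip by (elim conjE allE)
  ultimately have "K \<inter> \<Inter>\<C> \<noteq> {}" using clo by simp
  then show ?thesis by blast
qed

lemma compactin_chain_open:
  assumes K: "compactin T K" and clo: "\<And>C. C \<in> \<C> \<Longrightarrow> closedin T C" and "\<C> \<noteq> {}"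
    and chain: "\<And>C D. \<lbrakk>C \<in> \<C>; D \<in> \<C>\<rbrakk> \<Longrightarrow> C \<subseteq> D \<or> D \<subseteq> C"
    and N: "openin T N" "K \<inter> \<Inter>\<C> \<subseteq> N"
  shows "\<exists>C\<in>\<C>. K \<inter> C \<subseteq> N"
proof (rule ccontr)
  assume no: "\<not> ?thesis"
  have "\<exists>x\<in>K. \<forall>C\<in>(\<lambda>C. C - N) ` \<C>. x \<in> C"
  proof (rule compactin_chain[OF K])
    show "K \<noteq> {}" using no \<open>\<C> \<noteq> {}\<close> by blast
    show "closedin T C" if "C \<in> (\<lambda>C. C - N) ` \<C>" for C
      using that clo N(1) by (auto intro: closedin_diff)
    show "K \<inter> C \<noteq> {}" if "C \<in> (\<lambda>C. C - N) ` \<C>" for C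
      using that no by auto
    show "C \<subseteq> D \<or> D \<subseteq> C" if "C \<in> (\<lambda>C. C - N) ` \<C>" "D \<in> (\<lambda>C. C - N) ` \<C>" for C D
    proof -
      from that obtain C' D' where CD: "C' \<in> \<C>" "D' \<in> \<C>" "C = C' - N" "D = D' - N" by blast
      then show ?thesis unfolding CD(3,4) using chain[OF CD(1,2)] by blast
    qed
  qed
  then obtain x where x: "x \<in> K" "\<And>C. C \<in> \<C> \<Longrightarrow> x \<in> C - N" by auto
  obtain C where "C \<in> \<C>" using \<open>\<C> \<noteq> {}\<close> by blast
  then have "x \<notin> N" using x(2) by blast
  moreover have "x \<in> K \<inter> \<Inter>\<C>" using x by blast
  ultimately show False using N(2) by blast
qed

section \<open>Stable subgroups and attraction\<close>

context topological_automorphism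
begin

definition stable_subgroup :: "'a set \<Rightarrow> bool" where
  "stable_subgroup Q \<longleftrightarrow> subgroup Q G \<and> compactin T Q \<and> (\<forall>x\<in>Q. \<alpha> x \<in> Q) \<and> (\<forall>x\<in>Q. \<beta> x \<in> Q)"

text \<open>Convergence of the orbit to \<open>Q\<close>, tested on open subgroups since these form
  a base at \<open>\<one>\<close>. For \<open>Q = {\<one>}\<close> this is membership in
  \<open>contraction\<close>.\<close>

definition attracted :: "'a set \<Rightarrow> 'a \<Rightarrow> bool" where
  "attracted Q y \<longleftrightarrow> y \<in> carrier G \<and>
    (\<forall>W. subgroup W G \<longrightarrow> openin T W \<longrightarrow> (\<exists>m. \<forall>n\<ge>m. (\<alpha> ^^ n) y \<in> Q <#> W))"

lemma stable_subgroup_iter: "\<lbrakk>stable_subgroup Q; x \<in> Q\<rbrakk> \<Longrightarrow> (\<alpha> ^^ n) x \<in> Q"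
  by (induction n) (auto simp: stable_subgroup_def)

lemma attractedD:
  "\<lbrakk>attracted Q y; subgroup W G; openin T W\<rbrakk> \<Longrightarrow> \<exists>m. \<forall>n\<ge>m. (\<alpha> ^^ n) y \<in> Q <#> W"
  by (simp add: attracted_def)

lemma set_mult_left:
  assumes Q: "subgroup Q G" and W: "W \<subseteq> carrier G" and q: "q \<in> Q" and x: "x \<in> Q <#> W"
  shows "q \<otimes> x \<in> Q <#> W"
proof -
  obtain p w where p: "p \<in> Q" "w \<in> W" "x = p \<otimes> w" using x unfolding set_mult_def by blast
  have "p \<in> carrier G" "q \<in> carrier G" "w \<in> carrier G"
    using p q W subgroup.mem_carrier[OF Q] by auto
  then have "q \<otimes> x = (q \<otimes> p) \<otimes> w" using p(3) by (simp add: m_assoc)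
  then show ?thesis using subgroup.m_closed[OF Q q p(1)] p(2) unfolding set_mult_def by blast
qed

lemma attracted_left:
  assumes Q: "stable_subgroup Q" and y: "attracted Q y" and q: "q \<in> Q"
  shows "attracted Q (q \<otimes> y)"
  unfolding attracted_def
proof (intro conjI allI impI)
  have Qs: "subgroup Q G" using Q by (simp add: stable_subgroup_def)
  have c: "y \<in> carrier G" "q \<in> carrier G"
    using y q subgroup.mem_carrier[OF Qs] by (auto simp: attracted_def)
  then show "q \<otimes> y \<in> carrier G" by simp
  fix W assume W: "subgroup W G" "openin T W"
  then obtain m where m: "\<forall>n\<ge>m. (\<alpha> ^^ n) y \<in> Q <#> W" using attractedD[OF y] by blast
  have "(\<alpha> ^^ n) (q \<otimes> y) \<in> Q <#> W" if "n \<ge> m" for n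
    using set_mult_left[OF Qs subgroup.subset[OF W(1)] stable_subgroup_iter[OF Q q]] m that c by simp
  then show "\<exists>m. \<forall>n\<ge>m. (\<alpha> ^^ n) (q \<otimes> y) \<in> Q <#> W" by blast
qed

text \<open>The intersection consists of the points whose two-sided orbit stays in \<open>V\<close>.
  Applying the fact to the inverse automorphism as well makes it a stable subgroup when
  \<open>V\<close> is a compact subgroup.\<close>

lemma stable_part:
  assumes "x \<in> forward_part \<alpha> V \<inter> forward_part \<beta> V" "x \<in> carrier G"
  shows "\<alpha> x \<in> forward_part \<alpha> V \<inter> forward_part \<beta> V"
proof -
  have "(\<beta> ^^ n) (\<alpha> x) \<in> V" for n
  proof (cases n)
    case 0
    then show ?thesis using forward_partD[of x \<alpha> V 1] assms by simp
  next
    case (Suc k)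
    then show ?thesis
      using forward_partD[of x \<beta> V k] assms by (simp add: funpow_Suc_right del: funpow.simps)
  qed
  then show ?thesis using assms forward_part_step[of x \<alpha> V] by (auto simp: forward_part_def)
qed

end

section \<open>Shadowing, and attraction to smaller subgroups\<close>

context topological_automorphism
begin

text \<open>A pseudo-orbit in \<open>Q\<close> is shadowed by an orbit: at each time, the error is split by tidiness into a
  part that stays small in the past, which corrects the orbit, and a part that stays small in the
  future.\<close>

lemma shadowing:
  assumes Q: "stable_subgroup Q" and A: "subgroup A G" "openin T A"
    and tidy: "\<And>a. a \<in> A \<inter> Q \<Longrightarrow> \<exists>z\<in>forward_part \<beta> A \<inter> Q. inv z \<otimes> a \<in> forward_part \<alpha> A"
    and y: "y \<in> carrier G" "\<And>k. (\<alpha> ^^ k) y \<in> Q <#> {x \<in> A. \<alpha> x \<in> A}"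
  shows "\<exists>q\<in>Q. inv q \<otimes> y \<in> forward_part \<alpha> A"
proof -
  have Qs: "subgroup Q G" and Qcomp: "compactin T Q" using Q by (auto simp: stable_subgroup_def)
  have Qc: "Q \<subseteq> carrier G" and Ac: "A \<subseteq> carrier G"
    using subgroup.subset[OF Qs] subgroup.subset[OF A(1)] .
  have approx: "\<exists>q\<in>Q. \<forall>n\<le>k. (\<alpha> ^^ n) (inv q \<otimes> y) \<in> A" for k
  proof (induction k)
    case 0
    obtain q v where "q \<in> Q" "v \<in> A" "y = q \<otimes> v"
      using y(2)[of 0] unfolding set_mult_def by auto
    then show ?case using Qc Ac by (intro bexI[of _ q]) (auto simp: subset_iff)
  next
    case (Suc k)
    then obtain q where q: "q \<in> Q" "\<And>n. n \<le> k \<Longrightarrow> (\<alpha> ^^ n) (inv q \<otimes> y) \<in> A" by blast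
    obtain z v where z: "z \<in> Q" "v \<in> A" "\<alpha> v \<in> A" "(\<alpha> ^^ k) y = z \<otimes> v"
      using y(2)[of k] unfolding set_mult_def by auto
    define p where "p = (\<alpha> ^^ k) q"
    have p: "p \<in> Q" unfolding p_def by (rule stable_subgroup_iter[OF Q q(1)])
    have c: "q \<in> carrier G" "z \<in> carrier G" "v \<in> carrier G" "p \<in> carrier G"
      using q(1) z(1,2) p Qc Ac by auto
    \<comment> \<open>The discrepancy at time \<open>k\<close> between the orbit of \<open>q\<close>
      and the point \<open>z\<close> of the pseudo-orbit; both approximate
      \<open>(\<alpha> ^^ k) y\<close> within \<open>A\<close>.\<close>
    define a where "a = inv p \<otimes> z"
    have "inv p \<otimes> (z \<otimes> v) \<in> A" using q(2)[of k] c y(1) z(4) by (simp add: p_def)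
    then have "inv p \<otimes> (z \<otimes> v) \<otimes> inv v \<in> A"
      using z(2) A(1) by (simp add: subgroup.m_closed subgroup.m_inv_closed)
    then have "a \<in> A" using c by (simp add: a_def m_assoc)
    moreover have "a \<in> Q" using p z(1) Qs by (simp add: a_def subgroup.m_closed subgroup.m_inv_closed)
    ultimately obtain e where e: "e \<in> forward_part \<beta> A" "e \<in> Q" "inv e \<otimes> a \<in> forward_part \<alpha> A"
      using tidy by blast
    have ec: "e \<in> carrier G" using e(2) Qc by blast
    \<comment> \<open>Transporting the correction \<open>e\<close> back to time 0 does not disturb
      times up to \<open>k\<close>, because the backward orbit of \<open>e\<close> stays in
      \<open>A\<close>.\<close>
    define d where "d = (\<beta> ^^ k) e"
    have d: "d \<in> Q" unfolding d_def
      using e(2) Q by (induction k) (auto simp: stable_subgroup_def)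
    have dc: "d \<in> carrier G" using d Qc by blast
    have split: "inv (q \<otimes> d) \<otimes> y = inv d \<otimes> (inv q \<otimes> y)"
      using c dc y(1) by (simp add: inv_mult_group m_assoc)
    have "(\<alpha> ^^ n) (inv d \<otimes> (inv q \<otimes> y)) \<in> A" if "n \<le> Suc k" for n
    proof (cases "n = Suc k")
      case True
      have "inv ((\<alpha> ^^ k) d) \<otimes> (inv p \<otimes> (z \<otimes> v)) = (inv e \<otimes> a) \<otimes> v"
        using c ec by (simp add: d_def a_def m_assoc)
      then have "(\<alpha> ^^ n) (inv d \<otimes> (inv q \<otimes> y)) = \<alpha> ((inv e \<otimes> a) \<otimes> v)"
        using True c dc y(1) z(4) by (simp add: p_def del: step_mult)
      also have "\<dots> = \<alpha> (inv e \<otimes> a) \<otimes> \<alpha> v"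
        using c ec by (simp add: a_def)
      also have "\<dots> \<in> A" using forward_partD[OF e(3), of 1] z(3) A(1) by (simp add: subgroup.m_closed)
      finally show ?thesis .
    next
      case False
      then have n: "n \<le> k" using that by simp
      have "(\<alpha> ^^ n) d \<in> A"
        unfolding d_def iter_cancel_le[OF ec n] by (rule forward_partD[OF e(1)])
      then have "inv ((\<alpha> ^^ n) d) \<otimes> (\<alpha> ^^ n) (inv q \<otimes> y) \<in> A"
        using q(2)[OF n] A(1) by (simp add: subgroup.m_closed subgroup.m_inv_closed)
      then show ?thesis using c dc y(1) by simp
    qed
    then show ?case using subgroup.m_closed[OF Qs q(1) d] split by metis
  qed
  let ?C = "\<lambda>k. {q \<in> carrier G. inv q \<otimes> y \<in> swap.back_core k A}"
  have "\<exists>q\<in>Q. \<forall>k. q \<in> ?C k"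
  proof (rule compactin_nested[OF Qcomp])
    have "continuous_map T T (\<lambda>q. inv q \<otimes> y)" by (intro continuous_group_intros y(1))
    then show "closedin T (?C k)" for k
      using swap.closedin_back_core[OF closedin_open_subgroup[OF A]] closedin_preimage by blast
    show "?C (Suc k) \<subseteq> ?C k" for k using swap.back_core_Suc_subset by blast
    show "Q \<inter> ?C k \<noteq> {}" for k
    proof -
      obtain q where "q \<in> Q" "\<forall>n\<le>k. (\<alpha> ^^ n) (inv q \<otimes> y) \<in> A" using approx by blast
      then have "q \<in> Q \<inter> ?C k" using Qc y(1) by (auto simp: swap.back_core_def)
      then show ?thesis by blast
    qed
  qed
  then obtain q where q: "q \<in> Q" "\<And>k. inv q \<otimes> y \<in> swap.back_core k A" by blast
  have "(\<alpha> ^^ k) (inv q \<otimes> y) \<in> A" for k using q(2)[of k] by (simp add: swap.back_core_def)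
  then show ?thesis using q(1) unfolding forward_part_def by blast
qed

text \<open>From some time \<open>m\<close> on the orbit of \<open>y\<close> is close to a
  pseudo-orbit in \<open>Q\<close>, so \<open>shadowing\<close> gives \<open>z\<close> such that the
  orbit of \<open>x = inv z \<otimes> y\<close> stays in \<open>A\<close> from time \<open>m\<close>
  on. Accumulation points of this orbit lie in \<open>Q\<close> and have their two-sided orbits in
  \<open>A\<close>, which is the definition of \<open>R\<close>.\<close>

lemma attracted_to_smaller:
  assumes Q: "stable_subgroup Q" and y: "attracted Q y"
    and V: "subgroup V G" "openin T V" "compactin T V"
  shows "\<exists>z\<in>Q. \<exists>R. stable_subgroup R \<and> R \<subseteq> Q \<inter> V \<and> attracted R (inv z \<otimes> y)"
proof -
  have Qs: "subgroup Q G" and Qcomp: "compactin T Q" and Qa: "\<And>x. x \<in> Q \<Longrightarrow> \<alpha> x \<in> Q"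
    and Qb: "\<And>x. x \<in> Q \<Longrightarrow> \<beta> x \<in> Q"
    using Q by (auto simp: stable_subgroup_def)
  have Qc: "Q \<subseteq> carrier G" using subgroup.subset[OF Qs] .
  have yc: "y \<in> carrier G" using y by (simp add: attracted_def)
  have Qiter: "(\<beta> ^^ n) x \<in> Q" if "x \<in> Q" for n x using that by (induction n) (auto simp: Qb)
  from tidy_above[OF V Qs compactin_closed[OF Qcomp] Qa Qb] obtain n
    where n: "\<forall>v \<in> back_core n V \<inter> Q. \<exists>z \<in> forward_part \<beta> V \<inter> Q.
      inv z \<otimes> v \<in> forward_part \<alpha> (back_core n V)" by blast
  define A where "A = back_core n V"
  have A: "subgroup A G" "openin T A" "compactin T A" "A \<subseteq> carrier G" "A \<subseteq> V"
    using subgroup_back_core[OF V(1)] openin_back_core[OF V(2)] compactin_back_core[OF V(3)]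
      back_core_carrier back_core_subset by (auto simp: A_def)
  have tidy: "\<exists>z\<in>forward_part \<beta> A \<inter> Q. inv z \<otimes> a \<in> forward_part \<alpha> A" if "a \<in> A \<inter> Q" for a
    using n that forward_part_back_core[OF subgroup.subset[OF V(1)], of n] by (simp add: A_def)
  have eq: "A \<inter> {x \<in> carrier G. (\<alpha> ^^ 1) x \<in> A} = {x \<in> A. \<alpha> x \<in> A}" using A(4) by auto
  have "subgroup {x \<in> A. \<alpha> x \<in> A} G" "openin T {x \<in> A. \<alpha> x \<in> A}"
    using subgroups_Inter_pair[OF A(1) subgroup_preimage_iter[OF A(1), of 1]]
      openin_Int[OF A(2) openin_preimage_iter[OF A(2), of 1]] unfolding eq .
  then obtain m where m: "\<forall>n\<ge>m. (\<alpha> ^^ n) y \<in> Q <#> {x \<in> A. \<alpha> x \<in> A}"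
    using attractedD[OF y] by blast
  have "\<exists>q\<in>Q. inv q \<otimes> (\<alpha> ^^ m) y \<in> forward_part \<alpha> A"
  proof (rule shadowing[OF Q A(1,2) tidy])
    show "(\<alpha> ^^ m) y \<in> carrier G" using yc by simp
    show "(\<alpha> ^^ k) ((\<alpha> ^^ m) y) \<in> Q <#> {x \<in> A. \<alpha> x \<in> A}" for k
      using m by (simp add: iter_iter)
  qed
  then obtain q where q: "q \<in> Q" "inv q \<otimes> (\<alpha> ^^ m) y \<in> forward_part \<alpha> A" by blast
  have qc: "q \<in> carrier G" using q(1) Qc by blast
  define z where "z = (\<beta> ^^ m) q"
  have z: "z \<in> Q" "z \<in> carrier G" using Qiter[OF q(1)] qc by (auto simp: z_def)
  define x where "x = inv z \<otimes> y"
  have xc: "x \<in> carrier G" using z yc by (simp add: x_def)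
  have "(\<alpha> ^^ m) x = inv q \<otimes> (\<alpha> ^^ m) y" using z yc qc by (simp add: x_def z_def)
  then have xA: "(\<alpha> ^^ k) x \<in> A" if "k \<ge> m" for k
    using forward_partD[OF q(2), of "k - m"] that by (metis iter_iter le_add_diff_inverse2)
  have xQ: "attracted Q x"
    unfolding x_def using attracted_left[OF Q y] z(1) Qs by (simp add: subgroup.m_inv_closed)
  define R where "R = Q \<inter> (forward_part \<alpha> A \<inter> forward_part \<beta> A)"
  have Rs: "subgroup R G"
    unfolding R_def using Qs subgroup_forward_part[OF A(1)] swap.subgroup_forward_part[OF A(1)]
    by (intro subgroups_Inter_pair)
  have "closedin T R"
    unfolding R_def using compactin_closed[OF Qcomp] compactin_closed[OF A(3)]
    by (intro closedin_Int closedin_forward_part swap.closedin_forward_part)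
  then have Rcomp: "compactin T R" using closed_compactin[OF Qcomp] by (simp add: R_def)
  have Ra: "\<alpha> r \<in> R" if "r \<in> R" for r
    using that stable_part[of r A] Qa Qc by (auto simp: R_def)
  have Rb: "\<beta> r \<in> R" if "r \<in> R" for r
    using that swap.stable_part[of r A] Qb Qc by (auto simp: R_def)
  have R: "stable_subgroup R" using Rs Rcomp Ra Rb by (simp add: stable_subgroup_def)
  have RV: "R \<subseteq> Q \<inter> V" using subset_trans[OF forward_part_subset A(5)] by (auto simp: R_def)
  have Rc: "R \<subseteq> carrier G" using subgroup.subset[OF Rs] .
  have "\<exists>m. \<forall>n\<ge>m. (\<alpha> ^^ n) x \<in> R <#> W" if W: "subgroup W G" "openin T W" for W
  proof -
    have Wc: "W \<subseteq> carrier G" using subgroup.subset[OF W(1)] .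
    \<comment> \<open>Points whose orbit over the times from \<open>-k\<close> to \<open>k\<close>
      stays in \<open>A\<close>; inside \<open>Q\<close> these sets decrease to
      \<open>R\<close>.\<close>
    let ?B = "\<lambda>k. swap.back_core k A \<inter> back_core k A"
    have "\<exists>k. Q \<inter> ?B k \<subseteq> R <#> W"
    proof (rule compactin_nested_open[OF Qcomp])
      show "closedin T (?B k)" for k
        using swap.closedin_back_core closedin_back_core compactin_closed[OF A(3)]
        by (intro closedin_Int)
      show "?B (Suc k) \<subseteq> ?B k" for k
        using swap.back_core_Suc_subset back_core_Suc_subset by blast
      show "openin T (R <#> W)" by (rule openin_set_mult[OF W(2) Rc])
      show "x \<in> R <#> W" if "x \<in> Q" "\<And>n. x \<in> ?B n" for x
      proof -
        have "x \<in> R"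
          using that by (auto simp: R_def forward_part_def back_core_def swap.back_core_def)
        then have "x \<otimes> \<one> \<in> R <#> W"
          using subgroup.one_closed[OF W(1)] unfolding set_mult_def by blast
        then show ?thesis using \<open>x \<in> R\<close> Rc by (simp add: subset_iff)
      qed
    qed
    then obtain k where k: "Q \<inter> ?B k \<subseteq> R <#> W" by blast
    \<comment> \<open>Shrinking the error to \<open>W \<inter> ?B k\<close> keeps its own orbit in
      \<open>A\<close> over the same window of times.\<close>
    have "subgroup (W \<inter> ?B k) G" "openin T (W \<inter> ?B k)"
      using subgroup_back_core[OF A(1)] swap.subgroup_back_core[OF A(1)]
        openin_back_core[OF A(2)] swap.openin_back_core[OF A(2)] W
      by (auto intro!: subgroups_Inter_pair openin_Int)
    then obtain j where j: "\<forall>n\<ge>j. (\<alpha> ^^ n) x \<in> Q <#> (W \<inter> ?B k)"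
      using attractedD[OF xQ] by blast
    \<comment> \<open>Adding \<open>k\<close> to \<open>m\<close> ensures that even \<open>k\<close>
      steps before time \<open>n\<close> the orbit of \<open>x\<close> is already in
      \<open>A\<close>.\<close>
    have "(\<alpha> ^^ n) x \<in> R <#> W" if nn: "n \<ge> max j (m + k)" for n
    proof -
      have "(\<alpha> ^^ n) x \<in> Q <#> (W \<inter> ?B k)" using j nn by simp
      then obtain p w where p: "p \<in> Q" "w \<in> W" "w \<in> ?B k" "(\<alpha> ^^ n) x = p \<otimes> w"
        unfolding set_mult_def by blast
      have c: "p \<in> carrier G" "w \<in> carrier G" using p(1,2) Qc Wc by auto
      have pw: "p = (\<alpha> ^^ n) x \<otimes> inv w" using c by (simp add: p(4) m_assoc)
      have "(\<alpha> ^^ i) p \<in> A \<and> (\<beta> ^^ i) p \<in> A" if i: "i \<le> k" for i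
      proof
        have "(\<alpha> ^^ i) ((\<alpha> ^^ n) x) \<in> A" unfolding iter_iter using nn by (intro xA) simp
        moreover have "(\<alpha> ^^ i) w \<in> A" using p(3) i by (simp add: swap.back_core_def)
        ultimately show "(\<alpha> ^^ i) p \<in> A"
          unfolding pw using A(1) xc c by (simp add: subgroup.m_closed subgroup.m_inv_closed)
        have "(\<beta> ^^ i) ((\<alpha> ^^ n) x) = (\<alpha> ^^ (n - i)) x"
          using i nn xc by (intro swap.iter_cancel_le) auto
        moreover have "(\<alpha> ^^ (n - i)) x \<in> A" using i nn by (intro xA) arith
        ultimately have "(\<beta> ^^ i) ((\<alpha> ^^ n) x) \<in> A" by simp
        moreover have "(\<beta> ^^ i) w \<in> A" using p(3) i by (simp add: back_core_def)
        ultimately show "(\<beta> ^^ i) p \<in> A"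
          unfolding pw using A(1) xc c by (simp add: subgroup.m_closed subgroup.m_inv_closed)
      qed
      then have "p \<in> Q \<inter> ?B k" using p(1) c by (auto simp: back_core_def swap.back_core_def)
      then have "p \<in> R <#> W" using k by blast
      then obtain r u where r: "r \<in> R" "u \<in> W" "p = r \<otimes> u" unfolding set_mult_def by blast
      have "(\<alpha> ^^ n) x = r \<otimes> (u \<otimes> w)"
        using r c Rc Wc by (simp add: p(4) m_assoc subset_iff)
      moreover have "u \<otimes> w \<in> W" using r(2) p(2) W(1) by (simp add: subgroup.m_closed)
      ultimately show ?thesis using r(1) unfolding set_mult_def by blast
    qed
    then show ?thesis by blast
  qed
  then have "attracted R x" using xc by (simp add: attracted_def)
  then show ?thesis using z(1) R RV unfolding x_def by blast
qed

end

section \<open>From attraction to contraction by Zorn's lemma\<close>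

context topological_automorphism
begin

text \<open>By compactness of \<open>Q\<close>, some member \<open>R\<close> of the chain lies in
  \<open>\<Inter>\<R> <#> W\<close>. As \<open>W\<close> is a group, attraction to this
  \<open>R\<close> puts the late iterates of \<open>y\<close> in
  \<open>\<Inter>\<R> <#> W\<close>.\<close>

lemma attracted_Inter:
  assumes Q: "compactin T Q" and ne: "\<R> \<noteq> {}"
    and \<R>: "\<And>R. R \<in> \<R> \<Longrightarrow> stable_subgroup R \<and> R \<subseteq> Q \<and> attracted R y"
    and chain: "\<And>R S. \<lbrakk>R \<in> \<R>; S \<in> \<R>\<rbrakk> \<Longrightarrow> R \<subseteq> S \<or> S \<subseteq> R"
  shows "stable_subgroup (\<Inter>\<R>)" and "attracted (\<Inter>\<R>) y"
proof -
  have sub: "subgroup R G" and comp: "compactin T R" if "R \<in> \<R>" for R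
    using \<R>[OF that] by (auto simp: stable_subgroup_def)
  have I: "subgroup (\<Inter>\<R>) G" using sub ne by (intro subgroups_Inter) auto
  have cl: "closedin T R" if "R \<in> \<R>" for R using compactin_closed[OF comp[OF that]] .
  obtain R0 where R0: "R0 \<in> \<R>" using ne by blast
  have "closedin T (\<Inter>\<R>)" using cl ne by (intro closedin_Inter) auto
  then have "compactin T (\<Inter>\<R>)" using closed_compactin[OF comp[OF R0] Inter_lower[OF R0]] by simp
  moreover have "\<alpha> x \<in> \<Inter>\<R> \<and> \<beta> x \<in> \<Inter>\<R>" if "x \<in> \<Inter>\<R>" for x
    using that \<R> by (auto simp: stable_subgroup_def)
  ultimately show "stable_subgroup (\<Inter>\<R>)" using I by (simp add: stable_subgroup_def)
  have Ic: "\<Inter>\<R> \<subseteq> carrier G" using subgroup.subset[OF I] .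
  show "attracted (\<Inter>\<R>) y"
    unfolding attracted_def
  proof (intro conjI allI impI)
    show "y \<in> carrier G" using \<R>[OF R0] by (simp add: attracted_def)
    fix W assume W: "subgroup W G" "openin T W"
    have Wc: "W \<subseteq> carrier G" using subgroup.subset[OF W(1)] .
    have "\<exists>R\<in>\<R>. Q \<inter> R \<subseteq> \<Inter>\<R> <#> W"
    proof (rule compactin_chain_open[OF Q cl ne chain openin_set_mult[OF W(2) Ic]])
      show "Q \<inter> \<Inter>\<R> \<subseteq> \<Inter>\<R> <#> W"
      proof
        fix x assume x: "x \<in> Q \<inter> \<Inter>\<R>"
        then have "x \<otimes> \<one> \<in> \<Inter>\<R> <#> W"
          using subgroup.one_closed[OF W(1)] unfolding set_mult_def by blast
        moreover have "x \<in> carrier G" using x Ic by blast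
        ultimately show "x \<in> \<Inter>\<R> <#> W" by simp
      qed
    qed
    then obtain R where R: "R \<in> \<R>" "R \<subseteq> \<Inter>\<R> <#> W" using \<R> by blast
    then obtain m where m: "\<forall>n\<ge>m. (\<alpha> ^^ n) y \<in> R <#> W" using \<R> attractedD W by blast
    have "(\<alpha> ^^ n) y \<in> \<Inter>\<R> <#> W" if "n \<ge> m" for n
    proof -
      have "(\<alpha> ^^ n) y \<in> R <#> W" using m that by simp
      then obtain r w where r: "r \<in> R" "w \<in> W" "(\<alpha> ^^ n) y = r \<otimes> w"
        unfolding set_mult_def by blast
      have "r \<in> \<Inter>\<R> <#> W" using R(2) r(1) by (rule subsetD)
      then obtain s u where s: "s \<in> \<Inter>\<R>" "u \<in> W" "r = s \<otimes> u" unfolding set_mult_def by blast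
      have "s \<in> carrier G" "u \<in> carrier G" "w \<in> carrier G"
        using subsetD[OF Ic s(1)] subsetD[OF Wc s(2)] subsetD[OF Wc r(2)] .
      then have "(\<alpha> ^^ n) y = s \<otimes> (u \<otimes> w)" by (simp add: r(3) s(3) m_assoc)
      then show ?thesis
        using s(1) subgroup.m_closed[OF W(1) s(2) r(2)] unfolding set_mult_def by blast
    qed
    then show "\<exists>m. \<forall>n\<ge>m. (\<alpha> ^^ n) y \<in> \<Inter>\<R> <#> W" by blast
  qed
qed

text \<open>Zorn's lemma is applied to the cosets \<open>z R\<close> for which \<open>z\<^sup>-\<^sup>1 y\<close> is attracted to \<open>R\<close>.\<close>

theorem attracted_contraction:
  assumes Q: "stable_subgroup Q" and y: "attracted Q y"
  shows "\<exists>z\<in>Q. inv z \<otimes> y \<in> contraction"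
proof -
  have Qs: "subgroup Q G" and Qcomp: "compactin T Q" using Q by (auto simp: stable_subgroup_def)
  have Qc: "Q \<subseteq> carrier G" using subgroup.subset[OF Qs] .
  have yc: "y \<in> carrier G" using y by (simp add: attracted_def)
  define coset where "coset z R = {x \<in> carrier G. inv z \<otimes> x \<in> R}" for z R
  define good where "good z R \<longleftrightarrow> z \<in> Q \<and> stable_subgroup R \<and> R \<subseteq> Q \<and> attracted R (inv z \<otimes> y)"
    for z R
  define \<A> where "\<A> = {coset z R | z R. good z R}"
  \<comment> \<open>Moving the base point inside the coset changes \<open>inv z \<otimes> y\<close>
    only by a left factor in \<open>R\<close>, which does not affect attraction to
    \<open>R\<close>.\<close>
  have coset_recenter: "coset z R = coset w R \<and> good w R" if z: "good z R" and w: "w \<in> coset z R" for z w R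
  proof -
    have Rs: "subgroup R G" and zQ: "z \<in> Q" and RQ: "R \<subseteq> Q" and R: "stable_subgroup R"
      using z by (auto simp: good_def stable_subgroup_def)
    have wz: "inv z \<otimes> w \<in> R" and c: "w \<in> carrier G" "z \<in> carrier G"
      using w zQ Qc by (auto simp: coset_def)
    then have "inv (inv z \<otimes> w) \<in> R" using subgroup.m_inv_closed[OF Rs] by blast
    then have zw: "inv w \<otimes> z \<in> R" using c by (simp add: inv_mult_group)
    have "inv z \<otimes> x \<in> R \<longleftrightarrow> inv w \<otimes> x \<in> R" if x: "x \<in> carrier G" for x
    proof
      assume "inv z \<otimes> x \<in> R"
      then have "(inv w \<otimes> z) \<otimes> (inv z \<otimes> x) \<in> R" by (rule subgroup.m_closed[OF Rs zw])
      then show "inv w \<otimes> x \<in> R" using c x by (simp add: m_assoc)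
    next
      assume "inv w \<otimes> x \<in> R"
      then have "(inv z \<otimes> w) \<otimes> (inv w \<otimes> x) \<in> R" by (rule subgroup.m_closed[OF Rs wz])
      then show "inv z \<otimes> x \<in> R" using c x by (simp add: m_assoc)
    qed
    then have "coset z R = coset w R" by (auto simp: coset_def)
    moreover have "z \<otimes> (inv z \<otimes> w) \<in> Q" using subgroup.m_closed[OF Qs zQ] wz RQ by blast
    then have "w \<in> Q" using c by simp
    moreover have "attracted R ((inv w \<otimes> z) \<otimes> (inv z \<otimes> y))"
      using attracted_left[OF R _ zw] z by (simp add: good_def)
    then have "attracted R (inv w \<otimes> y)" using c yc by (simp add: m_assoc)
    ultimately show ?thesis using R RQ by (simp add: good_def)
  qed
  have coset_self: "z \<in> coset z R" if "good z R" for z R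
    using that Qc by (auto simp: coset_def good_def stable_subgroup_def subgroup.one_closed)
  have coset_sub: "coset z R \<subseteq> Q" if z: "good z R" for z R
    using coset_recenter[OF z] by (auto simp: good_def)
  have coset_closed: "closedin T (coset z R)" if z: "good z R" for z R
    unfolding coset_def
  proof (rule closedin_preimage)
    have "z \<in> carrier G" using z Qc by (auto simp: good_def)
    then show "continuous_map T T (\<lambda>x. inv z \<otimes> x)" by (intro continuous_group_intros) auto
    show "closedin T R" using z compactin_closed by (simp add: good_def stable_subgroup_def)
  qed
  have coset_mono: "R \<subseteq> S" if "coset z R \<subseteq> coset z S" "R \<subseteq> Q" "z \<in> Q" for z R S
  proof
    fix r assume r: "r \<in> R"
    have c: "z \<in> carrier G" "r \<in> carrier G" using that(2,3) r Qc by auto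
    then have "z \<otimes> r \<in> coset z R" using r by (simp add: coset_def)
    then have "z \<otimes> r \<in> coset z S" using that(1) by blast
    then show "r \<in> S" using c by (simp add: coset_def)
  qed
  have "\<exists>m\<in>\<A>. \<forall>a\<in>\<A>. a \<subseteq> m \<longrightarrow> a = m"
  \<comment> \<open>The order is reverse inclusion, so a maximal element is a minimal coset.\<close>
  proof (rule predicate_Zorn[where P = "\<lambda>F F'. F' \<subseteq> F"])
    show "partial_order_on \<A> (relation_of (\<lambda>F F'. F' \<subseteq> F) \<A>)"
      by (intro partial_order_on_relation_ofI) auto
    fix \<C> assume C: "\<C> \<in> Chains (relation_of (\<lambda>F F'. F' \<subseteq> F) \<A>)"
    then have CA: "F \<in> \<A>" if "F \<in> \<C>" for F
      using that unfolding Chains_def relation_of_def by blast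
    have chain: "F \<subseteq> F' \<or> F' \<subseteq> F" if "F \<in> \<C>" "F' \<in> \<C>" for F F'
      using that C unfolding Chains_def relation_of_def by blast
    show "\<exists>u\<in>\<A>. \<forall>F\<in>\<C>. u \<subseteq> F"
    proof (cases "\<C> = {}")
      case True
      have "good \<one> Q" using Q y yc subgroup.one_closed[OF Qs] by (simp add: good_def)
      then show ?thesis using True unfolding \<A>_def by blast
    next
      case False
      \<comment> \<open>With a common point \<open>w\<close> as base point of every coset, the chain
        of cosets becomes a chain of subgroups.\<close>
      have "\<exists>w\<in>Q. \<forall>F\<in>\<C>. w \<in> F"
      proof (rule compactin_chain[OF Qcomp _ _ chain])
        show "Q \<noteq> {}" using subgroup.one_closed[OF Qs] by blast
        show "closedin T F" if "F \<in> \<C>" for F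
          using CA[OF that] coset_closed by (auto simp: \<A>_def)
        show "Q \<inter> F \<noteq> {}" if "F \<in> \<C>" for F
          using CA[OF that] coset_self by (auto simp: \<A>_def good_def)
      qed
      then obtain w where w: "w \<in> Q" "\<And>F. F \<in> \<C> \<Longrightarrow> w \<in> F" by blast
      define \<R> where "\<R> = {R. good w R \<and> coset w R \<in> \<C>}"
      have C\<R>: "\<exists>R\<in>\<R>. F = coset w R" if F: "F \<in> \<C>" for F
      proof -
        obtain z R where "good z R" "F = coset z R" using CA[OF F] by (auto simp: \<A>_def)
        moreover from this have "coset z R = coset w R \<and> good w R"
          using coset_recenter w(2)[OF F] by blast
        ultimately show ?thesis using F by (auto simp: \<R>_def)
      qed
      have ne: "\<R> \<noteq> {}" using C\<R> False by blast
      have \<R>1: "stable_subgroup R \<and> R \<subseteq> Q \<and> attracted R (inv w \<otimes> y)" if "R \<in> \<R>" for R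
        using that by (simp add: \<R>_def good_def)
      have \<R>2: "R \<subseteq> S \<or> S \<subseteq> R" if RS: "R \<in> \<R>" "S \<in> \<R>" for R S
      proof -
        have "coset w R \<subseteq> coset w S \<or> coset w S \<subseteq> coset w R"
          using RS by (intro chain) (auto simp: \<R>_def)
        then show ?thesis using coset_mono \<R>1 RS w(1) by blast
      qed
      have "good w (\<Inter>\<R>)"
        using attracted_Inter[OF Qcomp ne \<R>1 \<R>2] w(1) \<R>1 ne by (auto simp: good_def)
      moreover have "coset w (\<Inter>\<R>) \<subseteq> F" if "F \<in> \<C>" for F
        using C\<R>[OF that] by (auto simp: coset_def)
      ultimately show ?thesis unfolding \<A>_def by blast
    qed
  qed
  then obtain m where "m \<in> \<A>" and minimal: "\<And>a. \<lbrakk>a \<in> \<A>; a \<subseteq> m\<rbrakk> \<Longrightarrow> a = m" by blast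
  then obtain z R where zR: "good z R" "m = coset z R" by (auto simp: \<A>_def)
  have Rs: "subgroup R G" and R: "stable_subgroup R" "R \<subseteq> Q" "attracted R (inv z \<otimes> y)" and zQ: "z \<in> Q"
    using zR by (auto simp: good_def stable_subgroup_def)
  have zc: "z \<in> carrier G" using zQ Qc by blast
  \<comment> \<open>A nontrivial \<open>r\<close> is avoided by some \<open>V\<close>, and passing
    to a stable subgroup inside \<open>R \<inter> V\<close> gives a strictly smaller coset.\<close>
  have "r = \<one>" if r: "r \<in> R" for r
  proof (rule ccontr)
    assume "r \<noteq> \<one>"
    have rc: "r \<in> carrier G" using r R(2) Qc by blast
    have "openin T (carrier G - {r})"
      using closedin_sing[OF rc] by (metis closedin_def topspace_eq)
    then obtain V where V: "subgroup V G" "openin T V" "compactin T V" "V \<subseteq> carrier G - {r}"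
      using small_subgroups[of "carrier G - {r}"] \<open>r \<noteq> \<one>\<close> by auto
    obtain w S where w: "w \<in> R" "stable_subgroup S" "S \<subseteq> R \<inter> V"
        "attracted S (inv w \<otimes> (inv z \<otimes> y))"
      using attracted_to_smaller[OF R(1,3) V(1-3)] by blast
    have wc: "w \<in> carrier G" using w(1) R(2) Qc by blast
    have wz: "z \<otimes> w \<in> coset z R" using w(1) wc zc by (simp add: coset_def)
    then have eq: "m = coset (z \<otimes> w) R" using coset_recenter[OF zR(1)] zR(2) by blast
    have zwQ: "z \<otimes> w \<in> Q" using wz coset_sub[OF zR(1)] by blast
    have "inv (z \<otimes> w) \<otimes> y = inv w \<otimes> (inv z \<otimes> y)"
      using zc wc yc by (simp add: inv_mult_group m_assoc)
    then have "good (z \<otimes> w) S" using w zwQ R(2) by (auto simp: good_def)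
    then have "coset (z \<otimes> w) S \<in> \<A>" unfolding \<A>_def by blast
    moreover have "coset (z \<otimes> w) S \<subseteq> m" unfolding eq using w(3) by (auto simp: coset_def)
    ultimately have "coset (z \<otimes> w) R \<subseteq> coset (z \<otimes> w) S" using minimal eq by blast
    then have "R \<subseteq> S" using coset_mono R(2) zwQ by blast
    then show False using r w(3) V(4) by blast
  qed
  then have R1: "R = {\<one>}" using subgroup.one_closed[OF Rs] by blast
  have "inv z \<otimes> y \<in> contraction"
  proof (rule contractionI)
    show "inv z \<otimes> y \<in> carrier G" using zc yc by simp
    fix V assume V: "subgroup V G" "openin T V" "compactin T V"
    have "R <#> V = V" unfolding R1 set_mult_def using subgroup.subset[OF V(1)] by (auto simp: subset_iff)
    then show "\<exists>m. \<forall>n\<ge>m. (\<alpha> ^^ n) (inv z \<otimes> y) \<in> V" using attractedD[OF R(3) V(1,2)] by simp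
  qed
  then show ?thesis using zQ by blast
qed

end

section \<open>Splitting off contracted factors and twisted conjugation\<close>

context topological_automorphism
begin

text \<open>Tidiness provides a factor \<open>p\<close> with backward orbit in \<open>V\<close>.
  Under \<open>\<beta>\<close> it is attracted to the group \<open>Q\<close> of points with
  two-sided orbit in \<open>V\<close>, so an element of \<open>Q\<close> makes it contracted; as
  \<open>Q\<close> lies in \<open>forward_part \<alpha> V\<close>, the other factor absorbs that
  element.\<close>

theorem contraction_decomposition:
  assumes N: "openin T N" "\<one> \<in> N"
  shows "\<exists>V. subgroup V G \<and> openin T V \<and> compactin T V \<and> V \<subseteq> N \<and>
    (\<forall>v\<in>V. \<exists>s\<in>swap.contraction \<inter> forward_part \<beta> V. v \<otimes> inv s \<in> forward_part \<alpha> V)"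
proof -
  obtain W where W: "subgroup W G" "openin T W" "compactin T W" "W \<subseteq> N"
    using small_subgroups[OF N] by blast
  have Wc: "W \<subseteq> carrier G" using subgroup.subset[OF W(1)] .
  have "closedin T (carrier G)" using closedin_topspace[of T] by (simp add: topspace_eq)
  from tidy_above[OF W(1-3) subgroup_self this] obtain n
    where "\<forall>v \<in> back_core n W \<inter> carrier G. \<exists>z \<in> forward_part \<beta> W \<inter> carrier G.
      inv z \<otimes> v \<in> forward_part \<alpha> (back_core n W)" by auto
  then have n: "\<exists>z \<in> forward_part \<beta> W. inv z \<otimes> v \<in> forward_part \<alpha> (back_core n W)"
    if "v \<in> back_core n W" for v
    using that subsetD[OF back_core_carrier that] by blast
  define V where "V = back_core n W"
  have V: "subgroup V G" "openin T V" "compactin T V" "V \<subseteq> W"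
    using subgroup_back_core[OF W(1)] openin_back_core[OF W(2)] compactin_back_core[OF W(3)]
      back_core_subset by (auto simp: V_def)
  have Vc: "V \<subseteq> carrier G" using subgroup.subset[OF V(1)] .
  have tidy: "\<exists>z\<in>forward_part \<beta> V. inv z \<otimes> v \<in> forward_part \<alpha> V" if "v \<in> V" for v
    using n that forward_part_back_core[OF Wc, of n] by (simp add: V_def)
  let ?F = "forward_part \<alpha> V" and ?B = "forward_part \<beta> V"
  have F: "subgroup ?F G" and B: "subgroup ?B G"
    using subgroup_forward_part[OF V(1)] swap.subgroup_forward_part[OF V(1)] .
  have cl: "closedin T ?F" "closedin T ?B"
    using closedin_forward_part swap.closedin_forward_part compactin_closed[OF V(3)] by auto
  have Bcomp: "compactin T ?B" using closed_compactin[OF V(3) forward_part_subset cl(2)] .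
  define Q where "Q = ?F \<inter> ?B"
  have Qs: "subgroup Q G" unfolding Q_def using F B by (rule subgroups_Inter_pair)
  have Qc: "Q \<subseteq> carrier G" using subgroup.subset[OF Qs] .
  have "compactin T Q" using closed_compactin[OF Bcomp _ closedin_Int[OF cl]] by (simp add: Q_def)
  moreover have "\<alpha> x \<in> Q" if "x \<in> Q" for x
    using stable_part[of x V] that Qc by (auto simp: Q_def)
  moreover have "\<beta> x \<in> Q" if "x \<in> Q" for x
    using swap.stable_part[of x V] that Qc by (auto simp: Q_def)
  ultimately have Q: "swap.stable_subgroup Q" using Qs by (simp add: swap.stable_subgroup_def)
  have attr: "swap.attracted Q p" if p: "p \<in> ?B" for p
    unfolding swap.attracted_def
  proof (intro conjI allI impI)
    show pc: "p \<in> carrier G" using subgroup.mem_carrier[OF B p] .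
    fix U assume U: "subgroup U G" "openin T U"
    have "\<exists>n. ?B \<inter> swap.back_core n V \<subseteq> Q <#> U"
    proof (rule compactin_nested_open[OF Bcomp])
      show "closedin T (swap.back_core n V)" for n
        using swap.closedin_back_core[OF compactin_closed[OF V(3)]] .
      show "swap.back_core (Suc n) V \<subseteq> swap.back_core n V" for n by (rule swap.back_core_Suc_subset)
      show "openin T (Q <#> U)" by (rule openin_set_mult[OF U(2) Qc])
      show "x \<in> Q <#> U" if "x \<in> ?B" "\<And>n. x \<in> swap.back_core n V" for x
      proof -
        have "x \<in> Q" using that by (auto simp: Q_def forward_part_def swap.back_core_def)
        then have "x \<otimes> \<one> \<in> Q <#> U"
          using subgroup.one_closed[OF U(1)] unfolding set_mult_def by blast
        then show ?thesis using subsetD[OF Qc \<open>x \<in> Q\<close>] by simp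
      qed
    qed
    then obtain k where k: "?B \<inter> swap.back_core k V \<subseteq> Q <#> U" by blast
    \<comment> \<open>The point \<open>(\<beta> ^^ m) p\<close> has at least \<open>m\<close>
      forward images in \<open>V\<close>, since they retrace the backward orbit of
      \<open>p\<close>.\<close>
    have "(\<beta> ^^ m) p \<in> Q <#> U" if m: "m \<ge> k" for m
    proof -
      have "(\<alpha> ^^ i) ((\<beta> ^^ m) p) \<in> V" if "i \<le> k" for i
        using iter_cancel_le[OF pc, of i m] that m forward_partD[OF p] by simp
      then have "(\<beta> ^^ m) p \<in> swap.back_core k V" using pc by (simp add: swap.back_core_def)
      then show ?thesis using k forward_part_steps[OF p] by blast
    qed
    then show "\<exists>m. \<forall>n\<ge>m. (\<beta> ^^ n) p \<in> Q <#> U" by blast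
  qed
  have "\<exists>s\<in>swap.contraction \<inter> ?B. v \<otimes> inv s \<in> ?F" if v: "v \<in> V" for v
  proof -
    \<comment> \<open>Tidiness is applied to \<open>inv v\<close>, so that after inversion the
      contracted factor stands on the right.\<close>
    obtain z where z: "z \<in> ?B" "inv z \<otimes> inv v \<in> ?F"
      using tidy[OF subgroup.m_inv_closed[OF V(1) v]] by blast
    define p where "p = inv z"
    have p: "p \<in> ?B" unfolding p_def using subgroup.m_inv_closed[OF B z(1)] .
    have c: "v \<in> carrier G" "z \<in> carrier G" "p \<in> carrier G"
      using subsetD[OF Vc v] subgroup.mem_carrier[OF B] z(1) p by auto
    obtain q where q: "q \<in> Q" "inv q \<otimes> p \<in> swap.contraction"
      using swap.attracted_contraction[OF Q attr[OF p]] by blast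
    have qc: "q \<in> carrier G" using q(1) Qc by blast
    have qB: "q \<in> ?B" and qF: "q \<in> ?F" using q(1) by (auto simp: Q_def)
    have sB: "inv q \<otimes> p \<in> ?B" using subgroup.m_closed[OF B subgroup.m_inv_closed[OF B qB] p] .
    have "inv (inv z \<otimes> inv v) \<otimes> q \<in> ?F"
      using subgroup.m_closed[OF F subgroup.m_inv_closed[OF F z(2)] qF] .
    also have "inv (inv z \<otimes> inv v) \<otimes> q = v \<otimes> inv (inv q \<otimes> p)"
      using c qc by (simp add: inv_mult_group p_def m_assoc)
    finally show ?thesis using sB q(2) by blast
  qed
  then show ?thesis using V W(4) by blast
qed

text \<open>In terms of the conjugation by \<open>x\<close>, this conjugates \<open>x u\<close> into \<open>x V\<^sub>-\<close>.\<close>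

theorem twisted_conjugate_into_forward_part:
  assumes V: "subgroup V G" "openin T V" "compactin T V"
    and dec: "\<And>v. v \<in> V \<Longrightarrow> \<exists>s\<in>swap.contraction \<inter> forward_part \<beta> V. v \<otimes> inv s \<in> forward_part \<alpha> V"
    and u: "u \<in> V"
  shows "\<exists>t \<in> T closure_of swap.contraction \<inter> V. inv (\<beta> t) \<otimes> (u \<otimes> t) \<in> forward_part \<alpha> V"
proof -
  have Vc: "V \<subseteq> carrier G" using subgroup.subset[OF V(1)] .
  have uc: "u \<in> carrier G" using u Vc by blast
  let ?B = "forward_part \<beta> V" and ?F = "forward_part \<alpha> V"
  have B: "subgroup ?B G" using swap.subgroup_forward_part[OF V(1)] .
  have Bcomp: "compactin T ?B"
    using closed_compactin[OF V(3) forward_part_subset] swap.closedin_forward_part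
      compactin_closed[OF V(3)] by blast
  \<comment> \<open>The limit taken below stays in this compact group, while the contraction group
    itself need not be closed.\<close>
  define S where "S = ?B \<inter> T closure_of swap.contraction"
  have S: "subgroup S G"
    unfolding S_def using B swap.subgroup_closure_contraction by (rule subgroups_Inter_pair)
  have Sc: "S \<subseteq> carrier G" using subgroup.subset[OF S] .
  have Scomp: "compactin T S" unfolding S_def by (rule compactin_Int_closure[OF Bcomp])
  have approx: "\<exists>t\<in>S. \<forall>i\<le>n. (\<alpha> ^^ i) (inv (\<beta> t) \<otimes> (u \<otimes> t)) \<in> V" for n
  proof (induction n)
    case 0
    show ?case using subgroup.one_closed[OF S] uc u by (intro bexI[of _ \<one>]) simp_all
  next
    case (Suc n)
    then obtain t where t: "t \<in> S" "\<And>i. i \<le> n \<Longrightarrow> (\<alpha> ^^ i) (inv (\<beta> t) \<otimes> (u \<otimes> t)) \<in> V" by blast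
    define w where "w = inv (\<beta> t) \<otimes> (u \<otimes> t)"
    have "w \<in> V" using t(2)[of 0] by (simp add: w_def)
    then obtain s where s: "s \<in> swap.contraction" "s \<in> ?B" "w \<otimes> inv s \<in> ?F" using dec by blast
    have sS: "s \<in> S" using s(1,2) swap.contraction_subset_closure by (auto simp: S_def)
    have c: "t \<in> carrier G" "s \<in> carrier G" "w \<in> carrier G"
      using subsetD[OF Sc t(1)] subsetD[OF Sc sS] subsetD[OF Vc \<open>w \<in> V\<close>] .
    define v where "v = w \<otimes> inv s"
    have v: "v \<in> ?F" "v \<in> carrier G" using s(3) c by (auto simp: v_def)
    have sv: "s = inv v \<otimes> w" using c by (simp add: v_def inv_mult_group m_assoc)
    \<comment> \<open>Replacing \<open>t\<close> by \<open>t \<otimes> inv s\<close> turns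
      \<open>w = v \<otimes> s\<close> into \<open>\<beta> s \<otimes> v\<close>. This gains one
      step: \<open>s\<close> stays in \<open>V\<close> up to time \<open>n\<close>, so
      \<open>\<beta> s\<close> does so up to time \<open>Suc n\<close>, and \<open>v\<close> stays
      in \<open>V\<close> forever.\<close>
    have split: "inv (\<beta> (t \<otimes> inv s)) \<otimes> (u \<otimes> (t \<otimes> inv s)) = \<beta> s \<otimes> v"
      using c uc by (simp add: v_def w_def inv_mult_group m_assoc)
    have "(\<alpha> ^^ i) (\<beta> s \<otimes> v) \<in> V" if i: "i \<le> Suc n" for i
    proof -
      have "(\<alpha> ^^ i) (\<beta> s) \<in> V"
      proof (cases i)
        case 0
        then show ?thesis using forward_partD[OF s(2), of 1] by simp
      next
        case (Suc j)
        have "(\<alpha> ^^ j) w \<in> V" using t(2)[of j] i Suc by (simp add: w_def)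
        moreover have "(\<alpha> ^^ j) v \<in> V" by (rule forward_partD[OF v(1)])
        ultimately have "(\<alpha> ^^ j) s \<in> V"
          unfolding sv using V(1) v(2) c(3) by (simp add: subgroup.m_closed subgroup.m_inv_closed)
        then show ?thesis using Suc c by (simp add: funpow_Suc_right del: funpow.simps)
      qed
      then show ?thesis using forward_partD[OF v(1), of i] V(1) c v(2) by (simp add: subgroup.m_closed)
    qed
    then have "\<forall>i\<le>Suc n. (\<alpha> ^^ i) (inv (\<beta> (t \<otimes> inv s)) \<otimes> (u \<otimes> (t \<otimes> inv s))) \<in> V"
      unfolding split by blast
    moreover have "t \<otimes> inv s \<in> S" using subgroup.m_closed[OF S t(1) subgroup.m_inv_closed[OF S sS]] .
    ultimately show ?case by blast
  qed
  let ?C = "\<lambda>n. {t \<in> carrier G. inv (\<beta> t) \<otimes> (u \<otimes> t) \<in> swap.back_core n V}"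
  have "\<exists>t\<in>S. \<forall>n. t \<in> ?C n"
  proof (rule compactin_nested[OF Scomp])
    have "continuous_map T T (\<lambda>t. inv (\<beta> t) \<otimes> (u \<otimes> t))"
      by (intro continuous_group_intros continuous_backward uc)
    then show "closedin T (?C n)" for n
      using swap.closedin_back_core[OF compactin_closed[OF V(3)]] closedin_preimage by blast
    show "?C (Suc n) \<subseteq> ?C n" for n using swap.back_core_Suc_subset by blast
    show "S \<inter> ?C n \<noteq> {}" for n
    proof -
      obtain t where "t \<in> S" "\<forall>i\<le>n. (\<alpha> ^^ i) (inv (\<beta> t) \<otimes> (u \<otimes> t)) \<in> V" using approx by blast
      then have "t \<in> S \<inter> ?C n" using Sc uc by (auto simp: swap.back_core_def)
      then show ?thesis by blast
    qed
  qed
  then obtain t where t: "t \<in> S" "\<And>n. inv (\<beta> t) \<otimes> (u \<otimes> t) \<in> swap.back_core n V" by blast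
  have "(\<alpha> ^^ n) (inv (\<beta> t) \<otimes> (u \<otimes> t)) \<in> V" for n
    using t(2)[of n] by (simp add: swap.back_core_def)
  then have "inv (\<beta> t) \<otimes> (u \<otimes> t) \<in> ?F" unfolding forward_part_def by blast
  moreover have "t \<in> T closure_of swap.contraction \<inter> V"
    using t(1) subsetD[OF forward_part_subset, of t \<beta> V] by (auto simp: S_def)
  ultimately show ?thesis by blast
qed

end

section \<open>Conjugations and the relative Tits core\<close>

context group
begin

lemma normalizer_conj:
  assumes "D \<subseteq> carrier G" "n \<in> normalizer G D" "d \<in> D"
  shows "n \<otimes> d \<otimes> inv n \<in> D"
proof -
  have "n <# D #> inv n = D" using assms(1,2) by (simp add: normalizer_def stabilizer_def)
  moreover have "n \<otimes> d \<otimes> inv n \<in> n <# D #> inv n"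
    using assms(3) unfolding l_coset_def r_coset_def by blast
  ultimately show ?thesis by simp
qed

lemma iter_conj:
  assumes "x \<in> carrier G" "y \<in> carrier G"
  shows "((\<lambda>y. x \<otimes> y \<otimes> inv x) ^^ n) y = x [^] n \<otimes> y \<otimes> inv (x [^] n)"
proof (induction n)
  case (Suc n)
  have "x [^] Suc n = x \<otimes> x [^] n" using assms(1) by (rule nat_pow_Suc2)
  then show ?case using Suc assms by (simp add: inv_mult_group m_assoc del: nat_pow_Suc)
qed (use assms in simp)

end

section \<open>Contraction groups of conjugations\<close>

context locally_profinite_group
begin

lemma topological_automorphism_conj:
  assumes x: "x \<in> carrier G"
  shows "topological_automorphism G T (\<lambda>y. x \<otimes> y \<otimes> inv x) (\<lambda>y. inv x \<otimes> y \<otimes> x)"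
proof unfold_locales
  show "(\<lambda>y. x \<otimes> y \<otimes> inv x) \<in> hom G G" "(\<lambda>y. inv x \<otimes> y \<otimes> x) \<in> hom G G"
    using x by (auto simp: hom_def m_assoc)
  show "continuous_map T T (\<lambda>y. x \<otimes> y \<otimes> inv x)" "continuous_map T T (\<lambda>y. inv x \<otimes> y \<otimes> x)"
    by (intro continuous_group_intros inv_closed x)+
qed (use x in \<open>simp_all add: m_assoc\<close>)

lemma contraction_conj:
  assumes x: "x \<in> carrier G"
  shows "topological_automorphism.contraction G T (\<lambda>y. x \<otimes> y \<otimes> inv x) = contraction_group G T x"
proof -
  interpret topological_automorphism G T "\<lambda>y. x \<otimes> y \<otimes> inv x" "\<lambda>y. inv x \<otimes> y \<otimes> x"
    using topological_automorphism_conj[OF x] .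
  show ?thesis
    unfolding contraction_def contraction_group_def limitin_def eventually_sequentially topspace_eq
    using x by (auto simp: iter_conj)
qed

text \<open>Conjugation by a compact set is uniformly continuous at \<open>\<one>\<close>:
  \<open>openin_conj_core\<close> gives one neighbourhood that all of \<open>K\<close> conjugates
  into \<open>V\<close>.\<close>

lemma limitin_conj_compact:
  assumes lim: "limitin T f \<one> sequentially" and f: "\<And>n. f n \<in> carrier G"
    and K: "compactin T K" "\<And>n. k n \<in> K"
  shows "limitin T (\<lambda>n. k n \<otimes> f n \<otimes> inv (k n)) \<one> sequentially"
  unfolding limitin_def
proof (intro conjI allI impI)
  show "\<one> \<in> topspace T" by (simp add: topspace_eq)
  fix N assume "openin T N \<and> \<one> \<in> N"
  then obtain V where V: "subgroup V G" "openin T V" "V \<subseteq> N"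
    using small_subgroups by blast
  let ?W = "{x \<in> carrier G. \<forall>k\<in>K. k \<otimes> x \<otimes> inv k \<in> V}"
  have "openin T ?W" by (rule openin_conj_core[OF K(1) V(1,2)])
  moreover have "\<one> \<in> ?W"
    using compactin_carrier[OF K(1)] V(1) by (auto simp: subgroup.one_closed subset_iff)
  ultimately have "\<forall>\<^sub>F n in sequentially. f n \<in> ?W" using lim unfolding limitin_def by blast
  then show "\<forall>\<^sub>F n in sequentially. k n \<otimes> f n \<otimes> inv (k n) \<in> N"
    by (rule eventually_mono) (use K(2) V(3) in blast)
qed

text \<open>The powers of \<open>x w\<close> and of \<open>x\<close> differ by elements of the compact group \<open>R\<close>.\<close>

lemma contraction_group_mult_right:
  assumes x: "x \<in> carrier G" and R: "subgroup R G" "compactin T R" "\<And>r. r \<in> R \<Longrightarrow> x \<otimes> r \<otimes> inv x \<in> R"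
    and w: "w \<in> R"
  shows "contraction_group G T (x \<otimes> w) = contraction_group G T x"
proof -
  have Rc: "R \<subseteq> carrier G" using subgroup.subset[OF R(1)] .
  have wc: "w \<in> carrier G" using w Rc by blast
  have "\<exists>r\<in>R. (x \<otimes> w) [^] n = r \<otimes> x [^] n" for n :: nat
  proof (induction n)
    case 0
    show ?case using subgroup.one_closed[OF R(1)] by (intro bexI[of _ \<one>]) simp_all
  next
    case (Suc n)
    then obtain r where r: "r \<in> R" "(x \<otimes> w) [^] n = r \<otimes> x [^] n" by blast
    have rc: "r \<in> carrier G" using r(1) Rc by blast
    have "(x \<otimes> w) [^] Suc n = (x \<otimes> w) \<otimes> (x \<otimes> w) [^] n"
      using x wc by (intro nat_pow_Suc2) simp
    also have "\<dots> = (x \<otimes> (w \<otimes> r) \<otimes> inv x) \<otimes> (x \<otimes> x [^] n)"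
      unfolding r(2) using x wc rc by (simp add: m_assoc)
    also have "x \<otimes> x [^] n = x [^] Suc n" using nat_pow_Suc2[OF x] by simp
    finally show ?case using R(3)[OF subgroup.m_closed[OF R(1) w r(1)]] by blast
  qed
  then obtain r where r: "\<And>n :: nat. r n \<in> R" "\<And>n. (x \<otimes> w) [^] n = r n \<otimes> x [^] n" by metis
  have rc: "r n \<in> carrier G" for n using r(1) Rc by blast
  have conj: "(x \<otimes> w) [^] n \<otimes> y \<otimes> inv ((x \<otimes> w) [^] n) = r n \<otimes> (x [^] n \<otimes> y \<otimes> inv (x [^] n)) \<otimes> inv (r n)"
    if "y \<in> carrier G" for y n
    unfolding r(2) using x rc that by (simp add: inv_mult_group m_assoc)
  have "limitin T (\<lambda>n::nat. (x \<otimes> w) [^] n \<otimes> y \<otimes> inv ((x \<otimes> w) [^] n)) \<one> sequentially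
      \<longleftrightarrow> limitin T (\<lambda>n::nat. x [^] n \<otimes> y \<otimes> inv (x [^] n)) \<one> sequentially" (is "?l \<longleftrightarrow> ?r")
    if y: "y \<in> carrier G" for y
  proof
    assume ?r
    from limitin_conj_compact[OF this _ R(2), of r] show ?l
      unfolding conj[OF y] using r(1) x y by simp
  next
    assume ?l
    from limitin_conj_compact[OF this _ R(2), of "\<lambda>n. inv (r n)"]
    have "limitin T (\<lambda>n. inv (r n) \<otimes> (r n \<otimes> (x [^] n \<otimes> y \<otimes> inv (x [^] n)) \<otimes> inv (r n)) \<otimes> inv (inv (r n)))
        \<one> sequentially"
      unfolding conj[OF y] using r(1) x y rc by (simp add: subgroup.m_inv_closed[OF R(1)])
    moreover have "inv (r n) \<otimes> (r n \<otimes> (x [^] n \<otimes> y \<otimes> inv (x [^] n)) \<otimes> inv (r n)) \<otimes> inv (inv (r n))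
        = x [^] n \<otimes> y \<otimes> inv (x [^] n)" for n :: nat
      using x y rc by (simp add: m_assoc)
    ultimately show ?r by simp
  qed
  then show ?thesis unfolding contraction_group_def by blast
qed

text \<open>\<open>H\<close> stands for the relative Tits core. The closure for \<open>inv x\<close>
  is used to replace \<open>x\<close> by an element of \<open>D\<close>, the closure for
  \<open>x\<close> to control commutators with that element.\<close>

theorem closure_contraction_group_subset:
  assumes D: "subgroup D G" and x: "x \<in> T closure_of D"
    and H: "T closure_of contraction_group G T x \<subseteq> H" "T closure_of contraction_group G T (inv x) \<subseteq> H"
    and U: "subgroup U G" "openin T U" "U \<inter> H \<subseteq> normalizer G D"
  shows "T closure_of contraction_group G T x \<subseteq> D"
proof -
  have Dc: "D \<subseteq> carrier G" using subgroup.subset[OF D] .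
  have xc: "x \<in> carrier G" using x closure_carrier by blast
  have N: "subgroup (normalizer G D) G" by (rule normalizer_imp_subgroup[OF Dc])
  interpret X: topological_automorphism G T "\<lambda>y. x \<otimes> y \<otimes> inv x" "\<lambda>y. inv x \<otimes> y \<otimes> x"
    using topological_automorphism_conj[OF xc] .
  have conb: "X.swap.contraction = contraction_group G T (inv x)"
    using contraction_conj[of "inv x"] xc by simp
  obtain V where V: "subgroup V G" "openin T V" "compactin T V" "V \<subseteq> U"
    and dec: "\<And>v. v \<in> V \<Longrightarrow> \<exists>s\<in>X.swap.contraction \<inter> forward_part (\<lambda>y. inv x \<otimes> y \<otimes> x) V.
      v \<otimes> inv s \<in> forward_part (\<lambda>y. x \<otimes> y \<otimes> inv x) V"
    using X.contraction_decomposition[OF U(2) subgroup.one_closed[OF U(1)]] by blast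
  let ?F = "forward_part (\<lambda>y. x \<otimes> y \<otimes> inv x) V"
  obtain d where d: "d \<in> D" "d \<in> carrier G" "inv x \<otimes> d \<in> V"
    using closure_approx[OF x V(2) subgroup.one_closed[OF V(1)]] by blast
  obtain t where t: "t \<in> T closure_of X.swap.contraction" "t \<in> V"
      "inv (inv x \<otimes> t \<otimes> x) \<otimes> ((inv x \<otimes> d) \<otimes> t) \<in> ?F"
    using X.twisted_conjugate_into_forward_part[OF V(1-3) dec d(3)] by blast
  have tc: "t \<in> carrier G" using t(1) closure_carrier by blast
  define w where "w = inv (inv x \<otimes> t \<otimes> x) \<otimes> ((inv x \<otimes> d) \<otimes> t)"
  define e where "e = x \<otimes> w"
  \<comment> \<open>\<open>t\<close> lies in \<open>V\<close>, hence in \<open>U\<close>, and in the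
    closure of the contraction group of \<open>inv x\<close>, hence in \<open>H\<close>.\<close>
  have "t \<in> normalizer G D" using t(1,2) V(4) H(2) U(3) unfolding conb by blast
  then have "inv t \<otimes> d \<otimes> inv (inv t) \<in> D"
    using normalizer_conj[OF Dc _ d(1)] subgroup.m_inv_closed[OF N] by blast
  also have "inv t \<otimes> d \<otimes> inv (inv t) = e"
    using xc tc d(2) by (simp add: e_def w_def inv_mult_group m_assoc)
  finally have e: "e \<in> D" .
  have ec: "e \<in> carrier G" using e Dc by blast
  have F: "subgroup ?F G" by (rule X.subgroup_forward_part[OF V(1)])
  have "compactin T ?F"
    using closed_compactin[OF V(3) forward_part_subset]
      X.closedin_forward_part[OF compactin_closed[OF V(3)]] .
  then have con_e: "contraction_group G T e = contraction_group G T x"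
    unfolding e_def using contraction_group_mult_right[OF xc F _ forward_part_step] t(3)
    by (simp add: w_def)
  interpret E: topological_automorphism G T "\<lambda>y. e \<otimes> y \<otimes> inv e" "\<lambda>y. inv e \<otimes> y \<otimes> e"
    using topological_automorphism_conj[OF ec] .
  have con: "E.contraction = contraction_group G T x" using contraction_conj[OF ec] con_e by simp
  \<comment> \<open>Now \<open>e\<close> belongs to \<open>D\<close>, so it normalises
    \<open>D\<close>; and for \<open>u\<close> normalising \<open>D\<close>, the commutator of
    \<open>u\<close> and \<open>e\<close> is a product of two elements of \<open>D\<close>.\<close>
  have "T closure_of E.contraction \<subseteq> D"
  proof (rule E.closure_contraction_subset[OF D _ U(1,2)])
    show "inv e \<otimes> y \<otimes> e \<in> D" if "y \<in> D" for y
      using that e D by (simp add: subgroup.m_closed subgroup.m_inv_closed)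
    show "u \<otimes> inv (e \<otimes> u \<otimes> inv e) \<in> D" if u: "u \<in> U" "u \<in> T closure_of E.contraction" for u
    proof -
      have uc: "u \<in> carrier G" using u(2) closure_carrier by blast
      have "u \<in> normalizer G D" using u H(1) U(3) unfolding con by blast
      then have "(u \<otimes> e \<otimes> inv u) \<otimes> inv e \<in> D"
        using normalizer_conj[OF Dc _ e] e D by (simp add: subgroup.m_closed subgroup.m_inv_closed)
      also have "(u \<otimes> e \<otimes> inv u) \<otimes> inv e = u \<otimes> inv (e \<otimes> u \<otimes> inv e)"
        using uc ec by (simp add: inv_mult_group m_assoc)
      finally show ?thesis .
    qed
  qed
  then show ?thesis unfolding con .
qed

end

theorem theorem1p5:
  fixes G (structure) and T :: "'a topology"
  assumes "topological_group G T"
    and "totally_disconnected_space T"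
    and "locally_compact_space T"
    and "subgroup D G"
    and "X \<subseteq> T closure_of D"
    and "\<exists>U. subgroup U G \<and> openin T U \<and> U \<inter> relative_Tits_core G T X \<subseteq> normalizer G D"
  shows "relative_Tits_core G T X \<subseteq> D"
proof -
  interpret topological_group G T by (rule assms(1))
  interpret locally_profinite_group G T
    using small_open_subgroup[OF assms(2,3)] by unfold_locales
  let ?H = "relative_Tits_core G T X"
  obtain U where U: "subgroup U G" "openin T U" "U \<inter> ?H \<subseteq> normalizer G D"
    using assms(6) by blast
  have cD: "subgroup (T closure_of D) G" by (rule subgroup_closure_of[OF assms(4)])
  have core: "T closure_of contraction_group G T x \<subseteq> ?H" if "x \<in> X \<union> set_inv X" for x
    unfolding relative_Tits_core_def using that by (auto intro: generate.incl)
  \<comment> \<open>The generating subgroups are treated one at a time. The index set is closed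
    under inversion and lies in the subgroup \<open>T closure_of D\<close>.\<close>
  have "T closure_of contraction_group G T x \<subseteq> D" if x: "x \<in> X \<union> set_inv X" for x
  proof (rule closure_contraction_group_subset[OF assms(4) _ core[OF x] core U])
    show "x \<in> T closure_of D"
      using x assms(5) subgroup.m_inv_closed[OF cD] by (auto simp: SET_INV_def)
    show "inv x \<in> X \<union> set_inv X"
      using x assms(5) closure_carrier by (force simp: SET_INV_def)
  qed
  then show ?thesis
    unfolding relative_Tits_core_def by (intro generate_subgroup_incl assms(4)) blast
qed

end
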